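(* Let $\epsilon>0$ and assume the Hall conjecture holds for this $\epsilon$, i.e. the inequality $0<|x^3-y^2|<|x|^{1/2-\epsilon}$ has only finitely many solutions in integers $(x,y)$. Then: (i) there is a constant $c_\epsilon>0$ such that for every irreducible polynomial $Q\in\mathbb{Z}[x]$ of degree $3$, with $B$ the absolute value of its leading coefficient and $A:=H(Q)/B$, $$\operatorname{sep}(Q)\ge \frac{c_\epsilon}{B^{2+\frac12+\epsilon}A^{2-\frac12+\epsilon}};$$ (ii) for every $r$ with $\frac12+\epsilon\le r\le 1$, $$(u,v)=\left(2r+\frac{2(1-r)}{1/2-\epsilon},\;2+r\right)\in D_{3,1};$$ (iii) moreover, for such $(u,v)$ one can explicitly compute a constant $c>0$ such that $$\left|\xi-\frac{p}{q}\right|>\frac{c}{H(\xi)^u q^v}$$ holds for all but finitely many pairs $(\xi,p/q)$ with $\xi$ a real cubic irrational and $p/q$ a rational number (with $q\ge1$); (iv) if an effective version of the Hall conjecture holds (i.e. an explicit constant $c'>0$ is known with $|x^3-y^2|>c'|x|^{1/2-\epsilon}$ for all integers $x,y$ with $x^3\ne y^2$), then one can explicitly compute $c^*>0$ such that $|\xi-p/q|>c^*H(\xi)^{-u}q^{-v}$ for all such pairs $(\xi,p/q)$.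
   Context: The naive height $H(P)$ of a polynomial $P\in\mathbb{Z}[x]$ is the maximum of the absolute values of its coefficients; for a real algebraic number $\xi$, $H(\xi)$ is the naive height of its minimal polynomial over $\mathbb{Z}$, and for a rational $p/q$ in lowest terms $H(p/q)=\max(|p|,|q|)$. For a polynomial with no multiple roots, $\operatorname{sep}$ denotes the minimum distance between two distinct complex roots. $\mathbb{A}_d$ is the set of real algebraic numbers of degree exactly $d$ ($\mathbb{A}_1=\mathbb{Q}$). $D_{3,1}$ is the set of pairs $(u,v)$ of positive reals for which there is a constant $c>0$ with $|\xi-\alpha|\ge cH(\xi)^{-u}H(\alpha)^{-v}$ for all $\xi\in\mathbb{A}_3$, $\alpha\in\mathbb{Q}$. *)

theory Defs
  imports
    Complex_Main
    "HOL-Library.Nat_Bijection"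
    "HOL-Computational_Algebra.Computational_Algebra"
begin

section \<open>Heights, root separation and approximation exponents\<close>

definition naive_height :: "int poly \<Rightarrow> int" where
  "naive_height P = Max ((\<lambda>i. \<bar>coeff P i\<bar>) ` {..degree P})"

text \<open>Irreducibility is meant in \<open>\<int>[x]\<close>, so the minimal polynomial is primitive; for a rational
  number \<open>p / q\<close> in lowest terms it is \<open>q x - p\<close>, of height \<open>max \<bar>p\<bar> \<bar>q\<bar>\<close>.\<close>

definition min_int_poly :: "real \<Rightarrow> int poly" where
  "min_int_poly \<xi> = (THE P. irreducible P \<and> lead_coeff P > 0 \<and> poly (map_poly of_int P) \<xi> = 0)"

definition alg_height :: "real \<Rightarrow> int" where
  "alg_height \<xi> = naive_height (min_int_poly \<xi>)"

definition real_alg_of_degree :: "nat \<Rightarrow> real set" where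
  "real_alg_of_degree d = {\<xi>. algebraic \<xi> \<and> degree (min_int_poly \<xi>) = d}"

definition root_sep :: "int poly \<Rightarrow> real" where
  "root_sep P = Min {cmod (z - w) | z w.
     poly (map_poly of_int P) z = 0 \<and> poly (map_poly of_int P) w = 0 \<and> z \<noteq> w}"

definition D31 :: "(real \<times> real) set" where
  "D31 = {(u, v). u > 0 \<and> v > 0 \<and>
     (\<exists>c>0. \<forall>\<xi>\<in>real_alg_of_degree 3. \<forall>\<alpha>\<in>\<rat>.
        \<bar>\<xi> - \<alpha>\<bar> \<ge> c * real_of_int (alg_height \<xi>) powr (- u) * real_of_int (alg_height \<alpha>) powr (- v))}"

section \<open>Hall's conjecture\<close>

definition hall_conjecture :: "real \<Rightarrow> bool" where
  "hall_conjecture \<epsilon> \<longleftrightarrow>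
     finite {(x :: int, y :: int). 0 < \<bar>x ^ 3 - y ^ 2\<bar> \<and>
       real_of_int \<bar>x ^ 3 - y ^ 2\<bar> < real_of_int \<bar>x\<bar> powr (1/2 - \<epsilon>)}"

definition effective_hall :: "real \<Rightarrow> real \<Rightarrow> bool" where
  "effective_hall \<epsilon> c' \<longleftrightarrow>
     (\<forall>x y :: int. x ^ 3 \<noteq> y ^ 2 \<longrightarrow>
       real_of_int \<bar>x ^ 3 - y ^ 2\<bar> > c' * real_of_int \<bar>x\<bar> powr (1/2 - \<epsilon>))"

section \<open>Computable functions of real numbers\<close>

text \<open>
  A constant that can be computed explicitly from real parameters is a computable function of
  these parameters in the usual sense of computable analysis: one fixed algorithm, given
  arbitrarily good approximations of the parameters, delivers arbitrarily good approximations of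
  the constant. The algorithms are the partial recursive (Kleene) functions relative to oracles
  \<open>\<Phi> 0\<close>, \<open>\<Phi> 1\<close>, \<dots>, one for each parameter.
\<close>

datatype recfun =
    Zero
  | Succ
  | Proj nat
  | Oracle nat
  | Comp recfun "recfun list"
  | PrimRec recfun recfun
  | Mu recfun

inductive computes :: "(nat \<Rightarrow> nat \<Rightarrow> nat) \<Rightarrow> recfun \<Rightarrow> nat list \<Rightarrow> nat \<Rightarrow> bool" for \<Phi> where
  zero: "computes \<Phi> Zero xs 0"
| succ: "computes \<Phi> Succ [x] (Suc x)"
| proj: "i < length xs \<Longrightarrow> computes \<Phi> (Proj i) xs (xs ! i)"
| orac: "computes \<Phi> (Oracle i) [x] (\<Phi> i x)"
| comp: "length ys = length gs \<Longrightarrow> (\<forall>i<length gs. computes \<Phi> (gs ! i) xs (ys ! i)) \<Longrightarrow>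
    computes \<Phi> f ys z \<Longrightarrow> computes \<Phi> (Comp f gs) xs z"
| prim_0: "computes \<Phi> f xs y \<Longrightarrow> computes \<Phi> (PrimRec f g) (0 # xs) y"
| prim_Suc: "computes \<Phi> (PrimRec f g) (n # xs) y \<Longrightarrow> computes \<Phi> g (n # y # xs) z \<Longrightarrow>
    computes \<Phi> (PrimRec f g) (Suc n # xs) z"
| mu: "computes \<Phi> f (n # xs) 0 \<Longrightarrow> (\<forall>m<n. \<exists>y. computes \<Phi> f (m # xs) (Suc y)) \<Longrightarrow>
    computes \<Phi> (Mu f) xs n"

inductive_cases computes_ZeroE: "computes \<Phi> Zero xs z"
inductive_cases computes_SuccE: "computes \<Phi> Succ xs z"
inductive_cases computes_ProjE: "computes \<Phi> (Proj i) xs z"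
inductive_cases computes_OracleE: "computes \<Phi> (Oracle i) xs z"
inductive_cases computes_CompE: "computes \<Phi> (Comp f gs) xs z"
inductive_cases computes_PrimRec_0E: "computes \<Phi> (PrimRec f g) (0 # xs) z"
inductive_cases computes_PrimRec_SucE: "computes \<Phi> (PrimRec f g) (Suc n # xs) z"
inductive_cases computes_MuE: "computes \<Phi> (Mu f) xs z"

lemma computes_deterministic:
  "computes \<Phi> p xs y \<Longrightarrow> computes \<Phi> p xs z \<Longrightarrow> y = z"
proof (induction arbitrary: z rule: computes.induct)
  case zero
  then show ?case by (rule computes_ZeroE) simp
next
  case succ
  then show ?case by (rule computes_SuccE) simp
next
  case proj
  from proj.prems show ?case by (rule computes_ProjE) simp
next
  case orac
  then show ?case by (rule computes_OracleE) simp
next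
  case (comp ys gs xs f y)
  from comp.prems obtain zs where zs: "length zs = length gs"
    "\<forall>i<length gs. computes \<Phi> (gs ! i) xs (zs ! i)" "computes \<Phi> f zs z"
    by (rule computes_CompE)
  have "ys ! i = zs ! i" if "i < length gs" for i
    using comp.IH(1) zs(2) that by blast
  then have "ys = zs"
    using comp.hyps(1) zs(1) by (simp add: list_eq_iff_nth_eq)
  with comp.IH(2) zs(3) show ?case by simp
next
  case prim_0
  from prim_0.prems prim_0.IH show ?case by (elim computes_PrimRec_0E) blast
next
  case (prim_Suc f g n xs y z')
  from prim_Suc.prems obtain y' where
    "computes \<Phi> (PrimRec f g) (n # xs) y'" "computes \<Phi> g (n # y' # xs) z"
    by (rule computes_PrimRec_SucE)
  with prim_Suc.IH show ?case by blast
next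
  case (mu f n xs)
  from mu.prems have z: "computes \<Phi> f (z # xs) 0 \<and> (\<forall>m<z. \<exists>y. computes \<Phi> f (m # xs) (Suc y))"
    by (rule computes_MuE) blast
  have "\<not> n < z"
  proof
    assume "n < z"
    then obtain y where "computes \<Phi> f (n # xs) (Suc y)" using z by blast
    then have "0 = Suc y" by (rule mu.IH(1))
    then show False by simp
  qed
  moreover have "\<not> z < n"
  proof
    assume "z < n"
    then obtain y where "\<forall>w. computes \<Phi> f (z # xs) w \<longrightarrow> Suc y = w" using mu.IH(2) by blast
    then have "Suc y = 0" using z by blast
    then show False by simp
  qed
  ultimately show ?case by simp
qed

text \<open>A name of \<open>x\<close> encodes, for each \<open>n\<close>, an integer \<open>k\<close> such that \<open>k / 2 ^ n\<close> is within
  \<open>1 / 2 ^ n\<close> of \<open>x\<close>.\<close>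

definition real_name :: "(nat \<Rightarrow> nat) \<Rightarrow> real \<Rightarrow> bool" where
  "real_name \<phi> x \<longleftrightarrow> (\<forall>n. \<bar>real_of_int (int_decode (\<phi> n)) - 2 ^ n * x\<bar> \<le> 1)"

definition computable_on :: "real list set \<Rightarrow> (real list \<Rightarrow> real) \<Rightarrow> bool" where
  "computable_on D F \<longleftrightarrow>
     (\<exists>p. \<forall>xs\<in>D. \<forall>\<Phi>. (\<forall>i<length xs. real_name (\<Phi> i) (xs ! i)) \<longrightarrow>
        (\<exists>\<psi>. real_name \<psi> (F xs) \<and> (\<forall>n. computes \<Phi> p [n] (\<psi> n))))"

end

theory Submission
  imports Defs
begin

text \<open>
  The covariants \<open>F\<close>, \<open>H\<close> (Hessian), \<open>G\<close> and the discriminant \<open>D\<close> of an integral binary cubic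
  form satisfy \<open>(4 H)\<^sup>3 - (4 G)\<^sup>2 = 432 D F\<^sup>2\<close>, so Hall's conjecture bounds \<open>D F\<^sup>2\<close> from below by a
  power of \<open>H\<close> at every integer point. At the point \<open>(1, 0)\<close>, \<open>F\<close> is the leading coefficient,
  and if two roots of the cubic are much closer to each other than to the third one, \<open>H\<close> is
  comparable to \<open>B\<^sup>2\<close> times the squared distance to that third root; since \<open>D\<close> contains the
  squared separation, this is (i). At a point \<open>(p, q)\<close> with \<open>p / q\<close> close to the root \<open>\<xi>\<close>, \<open>F\<close> is at most about
  \<open>q\<^sup>3 \<bar>Q'(\<xi>)\<bar> \<bar>\<xi> - p / q\<bar>\<close> and \<open>H\<close> is comparable to \<open>q\<^sup>2 Q'(\<xi>)\<^sup>2\<close>, which is the case \<open>r = 1/2 + \<epsilon>\<close>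
  of (ii). Liouville's inequality is the case \<open>r = 1\<close>, and a weighted geometric mean of the two
  bounds gives the rest. If \<open>(4 H, 4 G)\<close> is one of the finitely many exceptions to Hall's
  inequality, then \<open>q \<bar>Q'(\<xi>)\<bar>\<close> is bounded, and \<open>1 \<le> \<bar>F(p, q)\<bar>\<close> bounds the height of \<open>\<xi>\<close> and
  then \<open>q\<close>.
\<close>

subsection \<open>Computability of half a positive real\<close>

lemma computes_Comp1:
  "computes \<Phi> g xs y \<Longrightarrow> computes \<Phi> f [y] z \<Longrightarrow> computes \<Phi> (Comp f [g]) xs z"
  by (rule computes.comp[where ys = "[y]"]) auto

lemma computes_Comp2:
  "computes \<Phi> g xs y \<Longrightarrow> computes \<Phi> g' xs y' \<Longrightarrow> computes \<Phi> f [y, y'] z \<Longrightarrow>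
    computes \<Phi> (Comp f [g, g']) xs z"
  by (rule computes.comp[where ys = "[y, y']"]) (auto simp: less_Suc_eq)

text \<open>\<open>PrimRec\<close> hands its step function the counter as \<open>Proj 0\<close>, the
  previous value as \<open>Proj 1\<close>, and the remaining arguments after them.\<close>

definition rf_add :: recfun where
  "rf_add = PrimRec (Proj 0) (Comp Succ [Proj 1])"

definition rf_is_zero :: recfun where
  "rf_is_zero = PrimRec (Comp Succ [Zero]) Zero"

definition rf_parity :: recfun where
  "rf_parity = PrimRec Zero (Comp rf_is_zero [Proj 1])"

text \<open>Rests on \<open>Suc n div 2 = n div 2 + n mod 2\<close>, so halving becomes a running
  sum of parities.\<close>

definition rf_half :: recfun where
  "rf_half = PrimRec Zero (Comp rf_add [Proj 1, Comp rf_parity [Proj 0]])"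

lemma computes_Proj_0: "computes \<Phi> (Proj 0) (x # xs) x"
  using computes.proj[of 0 "x # xs"] by simp

lemma computes_Proj_1: "computes \<Phi> (Proj 1) (x # y # xs) y"
  using computes.proj[of 1 "x # y # xs"] by simp

lemma computes_rf_add: "computes \<Phi> rf_add [m, n] (m + n)"
  unfolding rf_add_def
proof (induction m)
  case 0
  show ?case by (auto intro: computes.prim_0 computes_Proj_0)
next
  case (Suc m)
  then show ?case
    by (auto intro!: computes.prim_Suc computes_Comp1 computes_Proj_1[unfolded One_nat_def] computes.succ)
qed

lemma computes_rf_is_zero: "computes \<Phi> rf_is_zero [n] (of_bool (n = 0))"
  unfolding rf_is_zero_def
proof (induction n)
  case 0
  show ?case
    by (auto intro!: computes.prim_0 computes_Comp1 computes.zero computes.succ)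
next
  case (Suc n)
  then show ?case by (auto intro!: computes.prim_Suc computes.zero)
qed

lemma computes_rf_parity: "computes \<Phi> rf_parity [n] (n mod 2)"
proof (induction n)
  case 0
  show ?case unfolding rf_parity_def by (auto intro: computes.prim_0 computes.zero)
next
  case (Suc n)
  have "Suc n mod 2 = of_bool (n mod 2 = 0)" by (auto simp: mod_Suc)
  then show ?case using Suc computes_rf_is_zero[of \<Phi> "n mod 2"] unfolding rf_parity_def
    by (metis computes.prim_Suc computes_Comp1 computes_Proj_1)
qed

lemma computes_rf_half: "computes \<Phi> rf_half [n] (n div 2)"
proof (induction n)
  case 0
  show ?case unfolding rf_half_def by (auto intro: computes.prim_0 computes.zero)
next
  case (Suc n)
  have "Suc n div 2 = n div 2 + n mod 2" by (cases "even n") (auto elim!: evenE oddE)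
  then show ?case using Suc computes_rf_add[of \<Phi> "n div 2" "n mod 2"] computes_rf_parity[of \<Phi> n]
    unfolding rf_half_def
    by (metis computes.prim_Suc computes_Comp1 computes_Comp2 computes_Proj_0 computes_Proj_1)
qed

text \<open>\<^const>\<open>int_encode\<close> maps a nonnegative \<open>j\<close> to \<open>2 * j\<close>, so on codes of
  nonnegative integers this is rounded halving.\<close>

definition rf_halve_code :: recfun where
  "rf_halve_code = Comp rf_add [Comp rf_half [rf_half], Comp rf_half [rf_half]]"

lemma computes_rf_halve_code: "computes \<Phi> rf_halve_code [n] (2 * (n div 4))"
proof -
  have "computes \<Phi> (Comp rf_half [rf_half]) [n] (n div 4)"
    using computes_Comp1[OF computes_rf_half[of \<Phi> n] computes_rf_half] by (simp add: div_mult2_eq[symmetric])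
  from computes_Comp2[OF this this computes_rf_add] show ?thesis
    unfolding rf_halve_code_def by (simp add: mult_2)
qed

lemma int_decode_halve_code:
  assumes "int_decode m \<ge> 0"
  shows "int_decode (2 * (m div 4)) = int_decode m div 2"
proof -
  obtain j :: nat where j: "int_decode m = int j" using assms nonneg_int_cases by blast
  have "m = int_encode (int j)" by (simp flip: j)
  then have "m = 2 * j" by (simp add: int_encode_def sum_encode_def)
  then have "2 * (m div 4) = int_encode (int (j div 2))"
    by (simp add: int_encode_def sum_encode_def)
  then show ?thesis by (simp add: j zdiv_int)
qed

text \<open>Halving an approximation halves its error to at most 1/2, and rounding down adds at most
  1/2, so the tolerance 1 of a name is preserved. Positivity of \<open>x\<close> keeps all
  approximants nonnegative, where the action on codes is rounded halving.\<close>

lemma real_name_half: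
  assumes "real_name \<phi> x" "x > 0"
  shows "real_name (\<lambda>n. 2 * (\<phi> n div 4)) (x / 2)"
  unfolding real_name_def
proof
  fix n
  let ?j = "int_decode (\<phi> n)"
  have *: "\<bar>real_of_int ?j - 2 ^ n * x\<bar> \<le> 1" using assms(1) by (simp add: real_name_def)
  have "2 ^ n * x > 0" using assms(2) by simp
  with * have "real_of_int ?j > -1" by linarith
  then have j: "?j \<ge> 0" by linarith
  have "real_of_int ?j = 2 * real_of_int (?j div 2) + real_of_int (?j mod 2)"
    by (metis mult_div_mod_eq of_int_add of_int_mult of_int_numeral)
  moreover have "?j mod 2 = 0 \<or> ?j mod 2 = 1" by auto
  ultimately show "\<bar>real_of_int (int_decode (2 * (\<phi> n div 4))) - 2 ^ n * (x / 2)\<bar> \<le> 1"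
    using * unfolding int_decode_halve_code[OF j] by auto
qed

lemma computable_on_half:
  assumes "computable_on D F" "\<And>xs. xs \<in> D \<Longrightarrow> F xs > 0"
  shows "computable_on D (\<lambda>xs. F xs / 2)"
proof -
  obtain p where p: "\<And>xs \<Phi>. xs \<in> D \<Longrightarrow> (\<forall>i<length xs. real_name (\<Phi> i) (xs ! i)) \<Longrightarrow>
      \<exists>\<psi>. real_name \<psi> (F xs) \<and> (\<forall>n. computes \<Phi> p [n] (\<psi> n))"
    using assms(1) unfolding computable_on_def by blast
  have "\<exists>\<psi>. real_name \<psi> (F xs / 2) \<and> (\<forall>n. computes \<Phi> (Comp rf_halve_code [p]) [n] (\<psi> n))"
    if xs: "xs \<in> D" "\<forall>i<length xs. real_name (\<Phi> i) (xs ! i)" for xs \<Phi>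
    using p[OF xs] real_name_half[OF _ assms(2)[OF xs(1)]] computes_Comp1 computes_rf_halve_code
    by blast
  then show ?thesis unfolding computable_on_def by blast
qed

lemma computable_on_div_power2:
  assumes "computable_on D F" "\<And>xs. xs \<in> D \<Longrightarrow> F xs > 0"
  shows "computable_on D (\<lambda>xs. F xs / 2 ^ k)"
proof (induction k)
  case 0
  show ?case using assms(1) by simp
next
  case (Suc k)
  then show ?case using computable_on_half[OF Suc] assms(2) by (simp add: field_simps)
qed

text \<open>The program \<open>Oracle i\<close> copies the given name of the parameter.\<close>

lemma computable_on_nth:
  assumes "\<And>xs. xs \<in> D \<Longrightarrow> i < length xs"
  shows "computable_on D (\<lambda>xs. xs ! i)"
  unfolding computable_on_def using assms computes.orac by blast

subsection \<open>Minimal polynomials over the integers\<close>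

abbreviation ipoly :: "int poly \<Rightarrow> 'a :: field_char_0 \<Rightarrow> 'a" where
  "ipoly P z \<equiv> poly (map_poly of_int P) z"

lemma ipoly_pCons: "ipoly (pCons a P) z = of_int a + z * ipoly P z"
  by (simp add: map_poly_pCons)

lemma ipoly_add: "ipoly (P + R) z = ipoly P z + ipoly R z"
  by (induction P R rule: poly_induct2) (auto simp: ipoly_pCons algebra_simps)

lemma ipoly_smult: "ipoly (smult a P) z = of_int a * ipoly P z"
  by (induction P) (auto simp: ipoly_pCons algebra_simps)

lemma ipoly_mult: "ipoly (P * R) z = ipoly P z * ipoly R z"
  by (induction P) (auto simp: ipoly_pCons ipoly_add ipoly_smult algebra_simps)

lemma degree_pos_if_ipoly_root:
  assumes "P \<noteq> 0" "ipoly P (z :: 'a :: field_char_0) = 0"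
  shows "degree P > 0"
proof (rule ccontr)
  assume "\<not> degree P > 0"
  then obtain a where "P = [:a:]" by (auto elim: degree_eq_zeroE)
  with assms show False by (simp add: ipoly_pCons)
qed

text \<open>A nonzero \<open>M\<close> of least degree vanishing at \<open>z\<close> divides a
  nonzero integer multiple of every polynomial vanishing at \<open>z\<close>. Irreducible elements
  of the integer polynomials are prime, so \<open>P\<close> divides \<open>M\<close>, hence a
  multiple \<open>c * R\<close>, and then \<open>R\<close>, because \<open>P\<close> is not
  constant.\<close>

lemma irreducible_dvd_if_common_root:
  fixes z :: "'a :: field_char_0" and P R :: "int poly"
  assumes P: "irreducible P" "ipoly P z = 0" and R: "ipoly R z = 0"
  shows "P dvd R"
proof -
  have P0: "P \<noteq> 0" using P by auto
  have prime: "prime_elem P" using P(1) by (rule irreducible_imp_prime_elem)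
  obtain M where M: "M \<noteq> 0" "ipoly M z = 0"
    and least: "\<And>T. T \<noteq> 0 \<Longrightarrow> ipoly T z = 0 \<Longrightarrow> degree M \<le> degree T"
    using ex_has_least_nat[of "\<lambda>T. T \<noteq> 0 \<and> ipoly T z = 0" P degree] P0 P(2) by blast
  \<comment> \<open>Pseudo-division, since the leading coefficient of \<open>M\<close> need not be a
    unit; minimality of \<open>M\<close> kills the remainder.\<close>
  have div: "\<exists>c S. c \<noteq> 0 \<and> smult c T = M * S" if "ipoly T z = 0" for T
  proof -
    obtain S V where SV: "pseudo_divmod T M = (S, V)" by fastforce
    define c where "c = coeff M (degree M) ^ (Suc (degree T) - degree M)"
    have *: "smult c T = M * S + V" "V = 0 \<or> degree V < degree M"
      using pseudo_divmod[OF M(1) SV] by (auto simp: c_def)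
    have "ipoly (smult c T) z = ipoly (M * S + V) z" using * by simp
    then have "ipoly V z = 0" using that M(2) by (simp add: ipoly_smult ipoly_add ipoly_mult)
    then have "V = 0" using least[of V] *(2) by fastforce
    then show ?thesis using * M(1) by (intro exI[of _ c] exI[of _ S]) (auto simp: c_def)
  qed
  have PM: "P dvd M"
  proof -
    obtain c S where cS: "c \<noteq> 0" "smult c P = M * S" using div[OF P(2)] by blast
    then have "P dvd M * S" by (metis dvd_refl dvd_smult)
    then consider "P dvd M" | "P dvd S" using prime prime_elem_dvd_mult_iff by blast
    then show ?thesis
    proof cases
      \<comment> \<open>Cancelling \<open>P\<close> leaves \<open>c = M * S'\<close>, so
        \<open>M\<close> would be a nonzero constant with a root.\<close>
      case 2
      then obtain S' where "S = P * S'" by blast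
      then have "P * [:c:] = P * (M * S')" using cS(2) by (simp add: mult_ac)
      then have eq: "[:c:] = M * S'" using P0 by (metis mult_left_cancel)
      then have "S' \<noteq> 0" using cS(1) by auto
      then have "degree (M * S') \<ge> degree M" using M(1) by (simp add: degree_mult_eq)
      then have "degree M = 0" by (simp flip: eq)
      then show ?thesis using degree_pos_if_ipoly_root[OF M] by simp
    qed
  qed
  obtain c S where cS: "c \<noteq> 0" "smult c R = M * S" using div[OF R] by blast
  then have "P dvd [:c:] * R" using PM by simp
  then have "P dvd [:c:] \<or> P dvd R" using prime prime_elem_dvd_mult_iff by blast
  moreover have "\<not> P dvd [:c:]"
    using dvd_imp_degree_le[of P "[:c:]"] cS(1) degree_pos_if_ipoly_root[OF P0 P(2)] by auto
  ultimately show ?thesis by blast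
qed

text \<open>Two irreducible polynomials with a common root differ by a unit, and positive leading
  coefficients force this unit to be 1. The definite description is therefore well defined.\<close>

lemma min_int_poly_eqI:
  assumes P: "irreducible P" "lead_coeff P > 0" "ipoly P \<xi> = 0"
  shows "min_int_poly \<xi> = P"
  unfolding min_int_poly_def
proof (rule the_equality)
  fix R :: "int poly"
  assume R: "irreducible R \<and> lead_coeff R > 0 \<and> ipoly R \<xi> = 0"
  obtain S where S: "R = P * S" using irreducible_dvd_if_common_root[of P \<xi> R] P R by blast
  then have "S dvd 1" using R P(1) irreducible_not_unit[of P] irreducibleD[of R P S] by blast
  then obtain c where c: "S = [:c:]" "c dvd 1" by (auto simp: is_unit_poly_iff)
  moreover have "lead_coeff R = lead_coeff P * c" using lead_coeff_mult[of P S] by (simp add: S c)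
  then have "c > 0" using R P(2) by (metis zero_less_mult_pos)
  ultimately show "R = P" using S by auto
qed (use P in auto)

text \<open>Some prime factor of an annihilating integer polynomial vanishes at
  \<open>\<xi>\<close>; multiplying it by 1 or -1 makes its leading coefficient positive.\<close>

lemma algebraic_min_int_poly:
  assumes "algebraic \<xi>"
  shows "irreducible (min_int_poly \<xi>)" "lead_coeff (min_int_poly \<xi>) > 0"
    "ipoly (min_int_poly \<xi>) \<xi> = 0"
proof -
  obtain T where T: "T \<noteq> 0" "ipoly T \<xi> = 0" using assms by (rule algebraicE')
  obtain A where A: "\<And>P. P \<in># A \<Longrightarrow> prime_elem P" "normalize (prod_mset A) = normalize T"
    by (rule prime_factorization_exists'[OF T(1)]) blast
  \<comment> \<open>The factorization holds only up to a unit, but divisibility is enough to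
    transfer the root.\<close>
  have "T dvd prod_mset A" using A(2) by (simp add: associated_iff_dvd)
  then obtain U where "prod_mset A = T * U" by (rule dvdE)
  then have "ipoly (prod_mset A) \<xi> = 0" using T(2) by (simp add: ipoly_mult)
  then have "\<exists>P\<in>#A. ipoly P \<xi> = 0"
    by (induction A) (auto simp: ipoly_mult)
  then obtain P where P: "irreducible P" "ipoly P \<xi> = 0"
    using A(1) prime_elem_imp_irreducible by blast
  define s where "s = (if lead_coeff P > 0 then 1 else -1 :: int)"
  define R where "R = [:s:] * P"
  have "lead_coeff P \<noteq> 0" using P(1) by auto
  moreover have "lead_coeff R = s * lead_coeff P" by (simp add: R_def s_def)
  ultimately have "lead_coeff R > 0"
    by (auto simp: s_def simp del: leading_coeff_0_iff split: if_splits)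
  moreover have "ipoly R \<xi> = 0" using P(2) by (simp add: R_def ipoly_smult)
  moreover have "is_unit [:s:]" by (auto simp: s_def is_unit_const_poly_iff)
  then have "irreducible R" using P(1) unfolding R_def by (simp only: irreducible_mult_unit_left)
  ultimately have R: "lead_coeff R > 0" "ipoly R \<xi> = 0" "irreducible R" by blast+
  show "irreducible (min_int_poly \<xi>)" "lead_coeff (min_int_poly \<xi>) > 0"
    "ipoly (min_int_poly \<xi>) \<xi> = 0"
    using min_int_poly_eqI[OF R(3,1,2)] R by simp_all
qed

lemma abs_coeff_le_naive_height: "\<bar>coeff P i\<bar> \<le> naive_height P"
proof (cases "i \<le> degree P")
  case True
  then show ?thesis unfolding naive_height_def by (intro Max_ge) auto
next
  case False
  then have "coeff P i = 0" by (simp add: coeff_eq_0)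
  moreover have "\<bar>coeff P 0\<bar> \<le> naive_height P" unfolding naive_height_def by (intro Max_ge) auto
  ultimately show ?thesis by simp
qed

text \<open>This turns lower bounds in terms of the denominator into the weaker ones in terms of the
  height that \<open>D31\<close> asks for. Coprimality makes \<open>q x - p\<close> primitive, hence
  irreducible.\<close>

lemma denominator_le_alg_height:
  assumes "coprime p q" "q \<ge> 1"
  shows "q \<le> alg_height (real_of_int p / real_of_int q)"
proof -
  have "irreducible [:- p, q:]" 
    using assms by (intro irreducible_linear_poly) (auto simp: coprime_commute)
  then have "min_int_poly (real_of_int p / real_of_int q) = [:- p, q:]"
    using assms(2) by (intro min_int_poly_eqI) (auto simp: ipoly_pCons)
  then show ?thesis
    using abs_coeff_le_naive_height[of "[:- p, q:]" 1] assms(2) by (simp add: alg_height_def)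
qed

subsection \<open>Covariants of binary cubic forms\<close>

definition cubic_form :: "'a::comm_ring_1 \<Rightarrow> 'a \<Rightarrow> 'a \<Rightarrow> 'a \<Rightarrow> 'a \<Rightarrow> 'a \<Rightarrow> 'a" where
  "cubic_form a b c d p q = a * p ^ 3 + b * p ^ 2 * q + c * p * q ^ 2 + d * q ^ 3"

definition cubic_disc :: "'a::comm_ring_1 \<Rightarrow> 'a \<Rightarrow> 'a \<Rightarrow> 'a \<Rightarrow> 'a" where
  "cubic_disc a b c d =
     b ^ 2 * c ^ 2 - 4 * a * c ^ 3 - 4 * b ^ 3 * d - 27 * a ^ 2 * d ^ 2 + 18 * a * b * c * d"

text \<open>This is -1/4 times the determinant of the second partial derivatives of
  \<open>cubic_form\<close>.\<close>

definition cubic_hess :: "'a::comm_ring_1 \<Rightarrow> 'a \<Rightarrow> 'a \<Rightarrow> 'a \<Rightarrow> 'a \<Rightarrow> 'a \<Rightarrow> 'a" where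
  "cubic_hess a b c d p q =
     (b ^ 2 - 3 * a * c) * p ^ 2 + (b * c - 9 * a * d) * p * q + (c ^ 2 - 3 * b * d) * q ^ 2"

text \<open>This is the Jacobian determinant of \<open>cubic_hess\<close> and
  \<open>cubic_form\<close> with respect to \<open>p\<close> and \<open>q\<close>.\<close>

definition cubic_covar :: "'a::comm_ring_1 \<Rightarrow> 'a \<Rightarrow> 'a \<Rightarrow> 'a \<Rightarrow> 'a \<Rightarrow> 'a \<Rightarrow> 'a" where
  "cubic_covar a b c d p q =
     (2 * b ^ 3 - 9 * a * b * c + 27 * a ^ 2 * d) * p ^ 3
     + 3 * (b ^ 2 * c - 6 * a * c ^ 2 + 9 * a * b * d) * p ^ 2 * q
     - 3 * (b * c ^ 2 - 6 * b ^ 2 * d + 9 * a * c * d) * p * q ^ 2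
     - (2 * c ^ 3 - 9 * b * c * d + 27 * a * d ^ 2) * q ^ 3"

text \<open>Cayley's syzygy \<open>4 H^3 = G^2 + 27 D F^2\<close>, multiplied by 16 so that the left
  side becomes an integer cube minus an integer square.\<close>

lemma cubic_syzygy:
  fixes a b c d p q :: int
  shows "(4 * cubic_hess a b c d p q) ^ 3 - (4 * cubic_covar a b c d p q) ^ 2
    = 432 * cubic_disc a b c d * (cubic_form a b c d p q) ^ 2"
proof -
  define A B C where "A = b ^ 2 - 3 * a * c" and "B = b * c - 9 * a * d" and "C = c ^ 2 - 3 * b * d"
  define G0 G1 G2 G3 where "G0 = 2 * b ^ 3 - 9 * a * b * c + 27 * a ^ 2 * d"
    and "G1 = 3 * (b ^ 2 * c - 6 * a * c ^ 2 + 9 * a * b * d)"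
    and "G2 = - 3 * (b * c ^ 2 - 6 * b ^ 2 * d + 9 * a * c * d)"
    and "G3 = - (2 * c ^ 3 - 9 * b * c * d + 27 * a * d ^ 2)"
  define D where "D = cubic_disc a b c d"
  note defs = A_def B_def C_def G0_def G1_def G2_def G3_def D_def cubic_disc_def
  \<comment> \<open>The seven coefficients of the sextic in \<open>p\<close> and \<open>q\<close>
    are compared one by one.\<close>
  have k: "4 * A ^ 3 - G0 ^ 2 = 27 * D * a ^ 2"
    "12 * A ^ 2 * B - 2 * G0 * G1 = 27 * D * (2 * a * b)"
    "12 * A ^ 2 * C + 12 * A * B ^ 2 - G1 ^ 2 - 2 * G0 * G2 = 27 * D * (b ^ 2 + 2 * a * c)"
    "24 * A * B * C + 4 * B ^ 3 - 2 * G0 * G3 - 2 * G1 * G2 = 27 * D * (2 * a * d + 2 * b * c)"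
    "12 * A * C ^ 2 + 12 * B ^ 2 * C - G2 ^ 2 - 2 * G1 * G3 = 27 * D * (c ^ 2 + 2 * b * d)"
    "12 * B * C ^ 2 - 2 * G2 * G3 = 27 * D * (2 * c * d)"
    "4 * C ^ 3 - G3 ^ 2 = 27 * D * d ^ 2"
    unfolding defs by algebra+
  have "4 * (A * p ^ 2 + B * p * q + C * q ^ 2) ^ 3
      - (G0 * p ^ 3 + G1 * p ^ 2 * q + G2 * p * q ^ 2 + G3 * q ^ 3) ^ 2
    = (4 * A ^ 3 - G0 ^ 2) * p ^ 6 + (12 * A ^ 2 * B - 2 * G0 * G1) * (p ^ 5 * q)
      + (12 * A ^ 2 * C + 12 * A * B ^ 2 - G1 ^ 2 - 2 * G0 * G2) * (p ^ 4 * q ^ 2)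
      + (24 * A * B * C + 4 * B ^ 3 - 2 * G0 * G3 - 2 * G1 * G2) * (p ^ 3 * q ^ 3)
      + (12 * A * C ^ 2 + 12 * B ^ 2 * C - G2 ^ 2 - 2 * G1 * G3) * (p ^ 2 * q ^ 4)
      + (12 * B * C ^ 2 - 2 * G2 * G3) * (p * q ^ 5) + (4 * C ^ 3 - G3 ^ 2) * q ^ 6"
    by algebra
  also have "\<dots> = 27 * D * (cubic_form a b c d p q) ^ 2"
    unfolding k cubic_form_def by algebra
  finally have main: "4 * (A * p ^ 2 + B * p * q + C * q ^ 2) ^ 3
      - (G0 * p ^ 3 + G1 * p ^ 2 * q + G2 * p * q ^ 2 + G3 * q ^ 3) ^ 2
    = 27 * D * (cubic_form a b c d p q) ^ 2" .
  have hess: "cubic_hess a b c d p q = A * p ^ 2 + B * p * q + C * q ^ 2"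
    by (simp add: cubic_hess_def A_def B_def C_def)
  have covar: "cubic_covar a b c d p q = G0 * p ^ 3 + G1 * p ^ 2 * q + G2 * p * q ^ 2 + G3 * q ^ 3"
    unfolding cubic_covar_def G0_def G1_def G2_def G3_def by algebra
  show ?thesis using main unfolding hess[symmetric] covar[symmetric] D_def
    by (simp add: power_mult_distrib)
qed

lemma of_int_cubic_disc:
  "of_int (cubic_disc a b c d) = cubic_disc (of_int a) (of_int b) (of_int c) (of_int d)"
  by (simp add: cubic_disc_def)

lemma of_int_cubic_hess:
  "of_int (cubic_hess a b c d p q)
    = cubic_hess (of_int a) (of_int b) (of_int c) (of_int d) (of_int p) (of_int q)"
  by (simp add: cubic_hess_def)

section \<open>Roots and discriminant of an irreducible integer cubic\<close>

lemma ipoly_cubic: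
  "ipoly [:d, c, b, a:] z = of_int a * z ^ 3 + of_int b * z ^ 2 + of_int c * z + of_int d"
  by (simp add: ipoly_pCons algebra_simps power2_eq_square power3_eq_cube)

text \<open>Two distinct roots suffice: the third is defined by the sum of the roots being
  \<open>- b / a\<close>, and dividing the difference of the two equations by \<open>z - w\<close>
  yields the formula for \<open>c\<close>.\<close>

lemma cubic_vieta:
  fixes a b c d z w :: "'a::field"
  assumes "a \<noteq> 0" "z \<noteq> w"
    and "a * z ^ 3 + b * z ^ 2 + c * z + d = 0" "a * w ^ 3 + b * w ^ 2 + c * w + d = 0"
  obtains v where "b = - a * (z + w + v)" "c = a * (z * w + z * v + w * v)" "d = - a * z * w * v"
proof
  define v where "v = - b / a - z - w"
  show b: "b = - a * (z + w + (- b / a - z - w))" using assms(1) by (simp add: field_simps)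
  have "(z - w) * (a * (z ^ 2 + z * w + w ^ 2) + b * (z + w) + c) = 0"
    using assms(3,4) by algebra
  then have "a * (z ^ 2 + z * w + w ^ 2) + b * (z + w) + c = 0" using assms(2) by simp
  then show c: "c = a * (z * w + z * (- b / a - z - w) + w * (- b / a - z - w))"
    using b unfolding v_def[symmetric] by algebra
  show "d = - a * z * w * (- b / a - z - w)"
    using b c assms(3) unfolding v_def[symmetric] by algebra
qed

text \<open>If \<open>norm z\<close> exceeds 2, the lower terms are at most
  \<open>h * (n^2 + n + 1)\<close>, hence at most \<open>2 * h * n^2\<close>, and \<open>n^2\<close>
  cancels. Keeping the factor \<open>norm a\<close> gives the bound \<open>2 * A\<close> for the
  roots in part (i).\<close>

lemma cubic_root_bound:
  fixes z :: "'a::real_normed_field"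
  assumes a: "a \<noteq> 0" and root: "a * z ^ 3 + b * z ^ 2 + c * z + d = 0"
    and h: "norm a \<le> h" "norm b \<le> h" "norm c \<le> h" "norm d \<le> h"
  shows "norm a * norm z \<le> 2 * h"
proof (cases "norm z \<le> 2")
  case True
  then show ?thesis using h(1) order_trans[OF norm_ge_zero h(1)] mult_mono[of "norm a" h "norm z" 2]
    by (simp add: mult.commute)
next
  case False
  define n where "n = norm z"
  have n: "n > 2" using False by (simp add: n_def)
  have "a * z ^ 3 = - (b * z ^ 2 + c * z + d)" using root by algebra
  then have "norm (a * z ^ 3) \<le> norm (b * z ^ 2) + norm (c * z) + norm d"
    by (metis norm_minus_cancel norm_triangle_mono norm_triangle_ineq order_refl)
  then have "norm a * n ^ 3 \<le> norm b * n ^ 2 + norm c * n + norm d"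
    by (simp add: norm_mult norm_power n_def)
  also have "\<dots> \<le> h * n ^ 2 + h * n + h"
    using h n by (intro add_mono mult_right_mono) auto
  also have "\<dots> \<le> h * (2 * n ^ 2)"
  proof -
    have "n * n \<ge> 2 * n" using n by (intro mult_right_mono) auto
    then have "n ^ 2 + n + 1 \<le> 2 * n ^ 2" using n unfolding power2_eq_square by linarith
    moreover have "h \<ge> 0" using h(1) norm_ge_zero order_trans by blast
    ultimately have "h * (n ^ 2 + n + 1) \<le> h * (2 * n ^ 2)" by (rule mult_left_mono)
    then show ?thesis by (simp add: algebra_simps)
  qed
  finally have "(norm a * n) * n ^ 2 \<le> (2 * h) * n ^ 2"
    by (simp add: power2_eq_square power3_eq_cube mult_ac)
  moreover have "n ^ 2 > 0" using n by simp
  ultimately show ?thesis unfolding n_def by (rule mult_right_le_imp_le)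
qed

text \<open>Otherwise the cubic would divide its own derivative, of degree 2.\<close>

lemma irreducible_cubic_deriv_nonzero:
  fixes z :: "'a::field_char_0"
  assumes "irreducible [:d, c, b, a:]" "a \<noteq> 0" "ipoly [:d, c, b, a:] z = 0"
  shows "3 * of_int a * z ^ 2 + 2 * of_int b * z + of_int c \<noteq> 0"
proof
  assume *: "3 * of_int a * z ^ 2 + 2 * of_int b * z + of_int c = 0"
  have "ipoly [:c, 2 * b, 3 * a:] z = 3 * of_int a * z ^ 2 + 2 * of_int b * z + of_int c"
    by (simp add: ipoly_pCons algebra_simps power2_eq_square)
  then have "[:d, c, b, a:] dvd [:c, 2 * b, 3 * a:]"
    using irreducible_dvd_if_common_root[OF assms(1,3)] * by simp
  then show False using dvd_imp_degree_le[of "[:d, c, b, a:]" "[:c, 2 * b, 3 * a:]"] assms(2) by simp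
qed

text \<open>A zero would make \<open>p / q\<close> a root, and the cubic would divide a linear
  polynomial.\<close>

lemma irreducible_cubic_form_nonzero:
  fixes a b c d p q :: int
  assumes "irreducible [:d, c, b, a:]" "a \<noteq> 0" "q \<noteq> 0"
  shows "cubic_form a b c d p q \<noteq> 0"
proof
  assume *: "cubic_form a b c d p q = 0"
  have "real_of_int (cubic_form a b c d p q) = q ^ 3 * ipoly [:d, c, b, a:] (p / q)"
    using assms(3)
    by (simp add: ipoly_cubic cubic_form_def field_simps power2_eq_square power3_eq_cube)
  then have "ipoly [:d, c, b, a:] (p / q) = 0" using * assms(3) by simp
  moreover have "ipoly [:- p, q:] (p / q) = 0" using assms(3) by (simp add: ipoly_pCons)
  ultimately have "[:d, c, b, a:] dvd [:- p, q:]"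
    using irreducible_dvd_if_common_root[OF assms(1)] by blast
  then show False using dvd_imp_degree_le[of "[:d, c, b, a:]" "[:- p, q:]"] assms(2,3) by simp
qed

text \<open>Split off one root \<open>z\<close>; the quadratic quotient has a root \<open>w\<close>,
  and its value at \<open>z\<close> is the derivative there, which is nonzero, so \<open>w\<close>
  differs from \<open>z\<close>.\<close>

lemma irreducible_cubic_two_roots:
  assumes "irreducible [:d, c, b, a:]" "a \<noteq> 0"
  shows "\<exists>z w :: complex. z \<noteq> w \<and> ipoly [:d, c, b, a:] z = 0 \<and> ipoly [:d, c, b, a:] w = 0"
proof -
  let ?Q = "map_poly of_int [:d, c, b, a:] :: complex poly"
  have "\<not> constant (poly ?Q)" using assms(2) by (simp add: constant_degree degree_map_poly)
  then obtain z where z: "poly ?Q z = 0" using fundamental_theorem_of_algebra by blast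
  define e l where "e = of_int a * z + of_int b" and "l = e * z + of_int c"
  have "\<not> constant (poly [:l, e, of_int a:])" using assms(2) by (simp add: constant_degree)
  then obtain w where "poly [:l, e, of_int a:] w = 0" using fundamental_theorem_of_algebra by blast
  then have w: "of_int a * w ^ 2 + e * w + l = 0" by (simp add: algebra_simps power2_eq_square)
  have "poly ?Q w = poly ?Q z + (w - z) * (of_int a * w ^ 2 + e * w + l)"
    unfolding ipoly_cubic e_def l_def by algebra
  then have "poly ?Q w = 0" using z w by simp
  moreover have "of_int a * z ^ 2 + e * z + l = 3 * of_int a * z ^ 2 + 2 * of_int b * z + of_int c"
    unfolding e_def l_def by algebra
  then have "of_int a * z ^ 2 + e * z + l \<noteq> 0" using irreducible_cubic_deriv_nonzero[OF assms z] by metis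
  then have "z \<noteq> w" using w by metis
  ultimately show ?thesis using z by blast
qed

text \<open>The discriminant is \<open>a^4\<close> times the squared product of the root
  differences; the derivative at \<open>z\<close>, being \<open>a * (z - w) * (z - v)\<close>, shows
  that the third root is distinct too.\<close>

lemma irreducible_cubic_disc_nonzero:
  fixes a b c d :: int
  assumes "irreducible [:d, c, b, a:]" "a \<noteq> 0"
  shows "cubic_disc a b c d \<noteq> 0"
proof -
  obtain z w :: complex where zw: "z \<noteq> w" "ipoly [:d, c, b, a:] z = 0" "ipoly [:d, c, b, a:] w = 0"
    using irreducible_cubic_two_roots[OF assms] by blast
  obtain v where v: "of_int b = - of_int a * (z + w + v)"
      "of_int c = of_int a * (z * w + z * v + w * v)" "of_int d = - of_int a * z * w * v"
    using cubic_vieta[of "of_int a" z w "of_int b" "of_int c" "of_int d"] assms(2) zw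
    unfolding ipoly_cubic by (metis of_int_eq_0_iff)
  have "3 * of_int a * z ^ 2 + 2 * of_int b * z + of_int c = of_int a * (z - w) * (z - v)"
    "3 * of_int a * w ^ 2 + 2 * of_int b * w + of_int c = of_int a * (w - z) * (w - v)"
    unfolding v by algebra+
  then have "z \<noteq> v" "w \<noteq> v" using irreducible_cubic_deriv_nonzero[OF assms] zw by fastforce+
  moreover have "of_int (cubic_disc a b c d) = of_int a ^ 4 * ((z - w) * (z - v) * (w - v)) ^ 2"
    unfolding of_int_cubic_disc unfolding cubic_disc_def v by algebra
  ultimately have "of_int (cubic_disc a b c d) \<noteq> (0 :: complex)" using zw(1) assms(2) by simp
  then show ?thesis by simp
qed

subsection \<open>Hall's conjecture\<close>

text \<open>Needed for \<open>c'^2 \<le> c'\<close> wherever a square root is taken.\<close>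

lemma effective_hall_less_1:
  assumes "effective_hall \<epsilon> c'"
  shows "c' < 1"
  using assms[unfolded effective_hall_def, rule_format, of 1 0] by simp

text \<open>Outside the finite exceptional set the constant 1 nearly works, and on it the left side
  is at least 1 while the right side is at most \<open>N\<close>. Taking \<open>N + 2\<close> makes
  both cases strict, also for \<open>N = 0\<close>.\<close>

lemma hall_conjecture_imp_effective_hall:
  assumes "hall_conjecture \<epsilon>"
  shows "\<exists>c'>0. effective_hall \<epsilon> c'"
proof -
  let ?f = "\<lambda>(x :: int, y :: int). real_of_int \<bar>x\<bar> powr (1/2 - \<epsilon>)"
  define E where "E = {(x :: int, y :: int). 0 < \<bar>x ^ 3 - y ^ 2\<bar> \<and>
       real_of_int \<bar>x ^ 3 - y ^ 2\<bar> < real_of_int \<bar>x\<bar> powr (1/2 - \<epsilon>)}"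
  have E: "finite E" using assms unfolding hall_conjecture_def E_def .
  define N where "N = sum ?f E"
  have N0: "N \<ge> 0" unfolding N_def by (intro sum_nonneg) auto
  have "real_of_int \<bar>x ^ 3 - y ^ 2\<bar> > 1 / (N + 2) * real_of_int \<bar>x\<bar> powr (1/2 - \<epsilon>)"
    if ne: "x ^ 3 \<noteq> y ^ 2" for x y :: int
  proof -
    have ge1: "real_of_int \<bar>x ^ 3 - y ^ 2\<bar> \<ge> 1" using ne by linarith
    show ?thesis
    proof (cases "(x, y) \<in> E")
      case True
      then have "?f (x, y) \<le> N" unfolding N_def using E by (intro member_le_sum) auto
      then have "1 / (N + 2) * real_of_int \<bar>x\<bar> powr (1/2 - \<epsilon>) < 1" using N0 by (simp add: field_simps)
      then show ?thesis using ge1 by linarith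
    next
      case False
      then have le: "real_of_int \<bar>x\<bar> powr (1/2 - \<epsilon>) \<le> real_of_int \<bar>x ^ 3 - y ^ 2\<bar>"
        using ne by (auto simp: E_def)
      have "1 * real_of_int \<bar>x ^ 3 - y ^ 2\<bar> < (N + 2) * real_of_int \<bar>x ^ 3 - y ^ 2\<bar>"
        using N0 ge1 by (intro mult_strict_right_mono) linarith+
      then have "real_of_int \<bar>x\<bar> powr (1/2 - \<epsilon>) < (N + 2) * real_of_int \<bar>x ^ 3 - y ^ 2\<bar>"
        unfolding mult_1 by (rule le_less_trans[OF le])
      then show ?thesis using N0 by (simp add: field_simps)
    qed
  qed
  then show ?thesis unfolding effective_hall_def using N0 by (intro exI[of _ "1 / (N + 2)"]) auto
qed

subsection \<open>Separation of the roots of a cubic\<close>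

text \<open>The purely real-variable part of (i): \<open>\<delta>\<close> is the distance of two
  roots, \<open>m\<close> the product of their distances to the third, and
  \<open>B^2 * \<delta> * m\<close> the square root of the absolute discriminant.\<close>

lemma hall_sep_bound:
  fixes A B \<delta> m c \<epsilon> :: real
  assumes B: "B \<ge> 1" and A: "A \<ge> 1" and \<delta>: "\<delta> > 0" and m: "m > 0" "m \<le> 16 * A ^ 2"
    and D: "B ^ 2 * \<delta> * m \<ge> 1" and c: "0 < c" "c < 1" and \<epsilon>: "\<epsilon> > 0"
    and hall: "\<epsilon> \<le> 1/2 \<Longrightarrow> 2 * \<delta> ^ 2 \<le> m \<Longrightarrow>
      c * (B ^ 2 * m) powr (1/2 - \<epsilon>) \<le> 432 * B ^ 6 * \<delta> ^ 2 * m ^ 2"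
  shows "\<delta> \<ge> c / 400 / (B powr (2 + 1/2 + \<epsilon>) * A powr (2 - 1/2 + \<epsilon>))"
proof -
  define X where "X = B powr (2 + 1/2 + \<epsilon>) * A powr (2 - 1/2 + \<epsilon>)"
  have B2: "B powr (2 + 1/2 + \<epsilon>) \<ge> B ^ 2"
    using B \<epsilon> powr_mono[of 2 "2 + 1/2 + \<epsilon>" B] by simp
  have A1: "A powr (2 - 1/2 + \<epsilon>) \<ge> 1" using A \<epsilon> by (simp add: ge_one_powr_ge_zero)
  have B1: "B ^ 2 \<ge> 1" using B by simp
  have XB: "X \<ge> B ^ 2" unfolding X_def using mult_mono[OF B2 A1] B1 by simp
  have X1: "X \<ge> 1" using XB B1 by linarith
  have "c / 400 \<le> \<delta> * X"
  proof -
    \<comment> \<open>For \<open>\<epsilon> > 1/2\<close> the discriminant bound alone suffices, as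
      \<open>A\<close> then carries an exponent above 2. If \<open>m < 2 * \<delta>^2\<close>, the
      two roots are not close compared with the third, and the discriminant bound gives
      \<open>B^2 * \<delta> \<ge> 1/2\<close> when \<open>\<delta> < 1\<close>.\<close>
    consider "\<epsilon> > 1/2" | "m < 2 * \<delta> ^ 2" | "\<epsilon> \<le> 1/2" "2 * \<delta> ^ 2 \<le> m" by linarith
    then show ?thesis
    proof cases
      case 1
      have "A powr (2 - 1/2 + \<epsilon>) \<ge> A ^ 2"
        using A 1 powr_mono[of 2 "2 - 1/2 + \<epsilon>" A] by simp
      then have "X \<ge> B ^ 2 * A ^ 2" unfolding X_def using B2 by (intro mult_mono) auto
      then have "\<delta> * X \<ge> \<delta> * (B ^ 2 * A ^ 2)" using \<delta> by simp
      moreover have "1 \<le> B ^ 2 * \<delta> * (16 * A ^ 2)"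
        using D mult_left_mono[OF m(2), of "B ^ 2 * \<delta>"] \<delta> by simp
      ultimately show ?thesis using c by (simp add: mult_ac)
    next
      case 2
      show ?thesis
      proof (cases "\<delta> \<ge> 1")
        case True
        then have "\<delta> * X \<ge> 1" using X1 mult_mono[of 1 \<delta> 1 X] by simp
        then show ?thesis using c by linarith
      next
        case False
        have "1 \<le> B ^ 2 * \<delta> * (2 * \<delta> ^ 2)"
          using D mult_left_mono[of m "2 * \<delta> ^ 2" "B ^ 2 * \<delta>"] \<delta> 2 by simp
        also have "\<dots> \<le> B ^ 2 * \<delta> * (2 * 1)"
          using False \<delta> by (intro mult_left_mono) (auto simp: power_le_one)
        finally have "1 \<le> 2 * (\<delta> * B ^ 2)" by (simp add: mult_ac)
        also have "\<dots> \<le> 2 * (\<delta> * X)" using XB \<delta> by simp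
        finally show ?thesis using c by linarith
      qed
    next
      case 3
      \<comment> \<open>Cancelling \<open>(B^2 * m) powr s\<close> leaves
        \<open>B powr (5 + 2 * \<epsilon>)\<close> and \<open>m powr (3/2 + \<epsilon>)\<close>.
        With \<open>m \<le> 16 * A^2\<close> these are, up to a constant, the square of the target
        denominator.\<close>
      define s where "s = 1/2 - \<epsilon>"
      have B6: "B ^ 6 = B powr (2 * s) * B powr (5 + 2 * \<epsilon>)"
        using B by (simp add: s_def powr_add[symmetric])
      have m2: "m ^ 2 = m powr s * m powr (3/2 + \<epsilon>)"
        using m by (simp add: s_def powr_add[symmetric])
      have "(B ^ 2 * m) powr s = (B ^ 2) powr s * m powr s" using B m by (simp add: powr_mult)
      also have "(B ^ 2) powr s = B powr (2 * s)" using B by (simp add: powr_powr flip: powr_numeral)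
      finally have "c * (B powr (2 * s) * m powr s) \<le> 432 * B ^ 6 * \<delta> ^ 2 * m ^ 2"
        using hall[OF 3] by (simp add: s_def)
      also have "\<dots> = (432 * \<delta> ^ 2 * B powr (5 + 2 * \<epsilon>) * m powr (3/2 + \<epsilon>)) * (B powr (2 * s) * m powr s)"
        unfolding B6 m2 by simp
      finally have le: "c \<le> 432 * \<delta> ^ 2 * B powr (5 + 2 * \<epsilon>) * m powr (3/2 + \<epsilon>)"
        using B m by (simp add: mult_le_cancel_right)
      have "m powr (3/2 + \<epsilon>) \<le> (16 * A ^ 2) powr (3/2 + \<epsilon>)"
        using m \<epsilon> by (intro powr_mono2) auto
      also have "\<dots> = 16 powr (3/2 + \<epsilon>) * (A ^ 2) powr (3/2 + \<epsilon>)" by (simp add: powr_mult)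
      also have "\<dots> \<le> 256 * (A ^ 2) powr (3/2 + \<epsilon>)"
        using 3 powr_mono[of "3/2 + \<epsilon>" 2 16] by (intro mult_right_mono) auto
      also have "(A ^ 2) powr (3/2 + \<epsilon>) = A powr (2 * (3/2 + \<epsilon>))"
        using A by (simp add: powr_powr flip: powr_numeral)
      also have "\<dots> = (A powr (2 - 1/2 + \<epsilon>)) ^ 2"
        by (simp add: power2_eq_square powr_add[symmetric])
      finally have "c \<le> 432 * \<delta> ^ 2 * B powr (5 + 2 * \<epsilon>) * (256 * (A powr (2 - 1/2 + \<epsilon>)) ^ 2)"
        using le mult_left_mono[of "m powr (3/2 + \<epsilon>)" _ "432 * \<delta> ^ 2 * B powr (5 + 2 * \<epsilon>)"]
        by (smt (verit) powr_ge_zero mult_nonneg_nonneg zero_le_power2)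
      moreover have "B powr (5 + 2 * \<epsilon>) = (B powr (2 + 1/2 + \<epsilon>)) ^ 2"
        by (simp add: power2_eq_square powr_add[symmetric])
      ultimately have *: "c \<le> 110592 * (\<delta> * X) ^ 2"
        by (simp add: X_def power_mult_distrib mult_ac)
      \<comment> \<open>The constant 400 works because 110592 is at most
        \<open>400^2\<close>.\<close>
      have "c ^ 2 \<le> c" using c by (simp add: power2_eq_square mult_left_le)
      then have "(c / 400) ^ 2 \<le> (\<delta> * X) ^ 2" using * c by (simp add: power_divide)
      then show ?thesis using \<delta> X1 by (intro power2_le_imp_le[of "c / 400"]) auto
    qed
  qed
  then show ?thesis using X1 unfolding X_def[symmetric] by (simp add: field_simps)
qed

text \<open>The syzygy at \<open>(1, 0)\<close>: there \<open>F = a\<close>, and the Hessian is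
  \<open>a^2 * ((z - w)^2 + (z - v) * (w - v))\<close>, dominated by its second term when
  \<open>z\<close> and \<open>w\<close> are close.\<close>

lemma irreducible_cubic_sep:
  fixes a b c d h :: int and z w :: complex
  assumes irr: "irreducible [:d, c, b, a:]" and a: "a \<noteq> 0"
    and h: "\<bar>a\<bar> \<le> h" "\<bar>b\<bar> \<le> h" "\<bar>c\<bar> \<le> h" "\<bar>d\<bar> \<le> h"
    and zw: "z \<noteq> w" "ipoly [:d, c, b, a:] z = 0" "ipoly [:d, c, b, a:] w = 0"
    and hall: "effective_hall \<epsilon> c'" "c' > 0" "\<epsilon> > 0"
    and B: "B = real_of_int \<bar>a\<bar>" and A: "A = real_of_int h / B"
  shows "cmod (z - w) \<ge> c' / 400 / (B powr (2 + 1/2 + \<epsilon>) * A powr (2 - 1/2 + \<epsilon>))"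
proof -
  obtain v where v: "of_int b = - of_int a * (z + w + v)"
      "of_int c = of_int a * (z * w + z * v + w * v)" "of_int d = - of_int a * z * w * v"
    using cubic_vieta[of "of_int a" z w "of_int b" "of_int c" "of_int d"] a zw
    unfolding ipoly_cubic by (metis of_int_eq_0_iff)
  have B1: "B \<ge> 1" using a B by linarith
  have "B \<le> real_of_int h" using h(1) B by linarith
  then have A1: "A \<ge> 1" using B1 unfolding A by simp
  have nB: "cmod (of_int a) = B" by (simp add: B)
  define \<delta> m where "\<delta> = cmod (z - w)" and "m = cmod (z - v) * cmod (w - v)"
  have disc: "of_int (cubic_disc a b c d) = of_int a ^ 4 * ((z - w) * (z - v) * (w - v)) ^ 2"
    unfolding of_int_cubic_disc unfolding cubic_disc_def v by algebra
  have "cmod (of_int (cubic_disc a b c d)) = B ^ 4 * (\<delta> * m) ^ 2"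
    unfolding disc by (simp add: norm_mult norm_power B \<delta>_def m_def power_mult_distrib)
  then have D: "real_of_int \<bar>cubic_disc a b c d\<bar> = (B ^ 2 * \<delta> * m) ^ 2"
    by (simp add: power_mult_distrib flip: power_mult)
  have disc0: "cubic_disc a b c d \<noteq> 0" using irreducible_cubic_disc_nonzero[OF irr a] .
  then have "1 \<le> (B ^ 2 * \<delta> * m) ^ 2" using D by linarith
  moreover have nonneg: "B ^ 2 * \<delta> * m \<ge> 0" by (simp add: \<delta>_def m_def)
  ultimately have D1: "B ^ 2 * \<delta> * m \<ge> 1" using power2_le_imp_le[of 1 "B ^ 2 * \<delta> * m"] by simp
  have \<delta>0: "\<delta> > 0" using zw(1) by (simp add: \<delta>_def)
  have m0: "m > 0" using D1 by (cases "m = 0") (auto simp: m_def)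
  have root_bound: "cmod x \<le> 2 * A" if "ipoly [:d, c, b, a:] x = 0" for x
  proof -
    have "cmod (of_int a) * cmod x \<le> 2 * of_int h"
      using that h a unfolding ipoly_cubic
      by (intro cubic_root_bound[of _ _ "of_int b" "of_int c" "of_int d"]) (auto simp flip: of_int_abs)
    then show ?thesis using B1 unfolding nB A by (simp add: field_simps)
  qed
  have "ipoly [:d, c, b, a:] v = 0" unfolding ipoly_cubic v by algebra
  then have "cmod v \<le> 2 * A" by (rule root_bound)
  moreover have "cmod z \<le> 2 * A" "cmod w \<le> 2 * A" using root_bound zw by blast+
  ultimately have "cmod (z - v) \<le> 4 * A" "cmod (w - v) \<le> 4 * A"
    using norm_triangle_ineq4[of z v] norm_triangle_ineq4[of w v] by linarith+
  then have "m \<le> (4 * A) * (4 * A)" unfolding m_def using A1 by (intro mult_mono) auto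
  then have m16: "m \<le> 16 * A ^ 2" by (simp add: power2_eq_square)
  have H: "c' * (B ^ 2 * m) powr (1/2 - \<epsilon>) \<le> 432 * B ^ 6 * \<delta> ^ 2 * m ^ 2"
    if eps: "\<epsilon> \<le> 1/2" and small: "2 * \<delta> ^ 2 \<le> m"
  proof -
    define x y where "x = 4 * cubic_hess a b c d 1 0" and "y = 4 * cubic_covar a b c d 1 0"
    have syz: "x ^ 3 - y ^ 2 = 432 * cubic_disc a b c d * a ^ 2"
      using cubic_syzygy[of a b c d 1 0] by (simp add: x_def y_def cubic_form_def)
    then have "x ^ 3 \<noteq> y ^ 2" using disc0 a by auto
    then have "c' * real_of_int \<bar>x\<bar> powr (1/2 - \<epsilon>) \<le> real_of_int \<bar>x ^ 3 - y ^ 2\<bar>"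
      using hall(1) unfolding effective_hall_def by fastforce
    also have "\<dots> = 432 * real_of_int \<bar>cubic_disc a b c d\<bar> * (real_of_int \<bar>a\<bar>) ^ 2"
      unfolding syz by (simp add: abs_mult)
    also have "\<dots> = 432 * B ^ 6 * \<delta> ^ 2 * m ^ 2"
      unfolding D B by (simp add: power_mult_distrib flip: power_mult power_add)
    finally have 1: "c' * real_of_int \<bar>x\<bar> powr (1/2 - \<epsilon>) \<le> 432 * B ^ 6 * \<delta> ^ 2 * m ^ 2" .
    have "of_int x = 4 * of_int a ^ 2 * ((z - w) ^ 2 + (z - v) * (w - v))"
      unfolding x_def of_int_mult of_int_cubic_hess unfolding cubic_hess_def v by simp algebra
    then have "cmod (of_int x) = 4 * B ^ 2 * cmod ((z - w) ^ 2 + (z - v) * (w - v))"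
      by (simp add: norm_mult norm_power B)
    moreover have "cmod ((z - w) ^ 2 + (z - v) * (w - v)) \<ge> m - \<delta> ^ 2"
      using norm_diff_ineq[of "(z - v) * (w - v)" "(z - w) ^ 2"]
      by (simp add: norm_mult norm_power \<delta>_def m_def add.commute)
    \<comment> \<open>A quarter is enough, since \<open>x\<close> is four times the Hessian.\<close>
    then have "cmod ((z - w) ^ 2 + (z - v) * (w - v)) \<ge> m / 4" using small m0 by linarith
    then have "4 * B ^ 2 * cmod ((z - w) ^ 2 + (z - v) * (w - v)) \<ge> 4 * B ^ 2 * (m / 4)"
      by (intro mult_left_mono) auto
    ultimately have "B ^ 2 * m \<le> real_of_int \<bar>x\<bar>" by simp
    then have "(B ^ 2 * m) powr (1/2 - \<epsilon>) \<le> real_of_int \<bar>x\<bar> powr (1/2 - \<epsilon>)"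
      using m0 eps by (intro powr_mono2) auto
    then show ?thesis using 1 hall(2) by (meson mult_left_mono less_imp_le order_trans)
  qed
  show ?thesis
    using hall_sep_bound[OF B1 A1 \<delta>0 m0 m16 D1 hall(2) effective_hall_less_1[OF hall(1)] hall(3) H]
    by (simp add: \<delta>_def)
qed

lemma degree_3_eq_pCons:
  assumes "degree P = 3"
  shows "P = [:coeff P 0, coeff P 1, coeff P 2, coeff P 3:]"
proof (rule poly_eqI)
  fix n
  show "coeff P n = coeff [:coeff P 0, coeff P 1, coeff P 2, coeff P 3:] n"
    using assms coeff_eq_0[of P n]
    by (auto simp: coeff_pCons numeral_eq_Suc split: nat.splits)
qed

text \<open>\<open>Min\<close> needs a finite nonempty set: a nonzero polynomial has finitely many
  roots, and an irreducible cubic has two distinct ones.\<close>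

lemma root_sep_attained:
  assumes "irreducible Q" "degree Q = 3"
  obtains z w where "z \<noteq> w" "ipoly Q z = 0" "ipoly Q w = 0" "root_sep Q = cmod (z - w)"
proof -
  let ?Z = "{z :: complex. ipoly Q z = 0}"
  let ?S = "{cmod (z - w) | z w. ipoly Q z = 0 \<and> ipoly Q w = 0 \<and> z \<noteq> w}"
  have "map_poly of_int Q \<noteq> (0 :: complex poly)" using assms(2) by (auto simp: map_poly_eq_0_iff)
  then have "finite ?Z" by (rule poly_roots_finite)
  then have "finite ((\<lambda>(z, w). cmod (z - w)) ` (?Z \<times> ?Z))" by simp
  moreover have "?S \<subseteq> (\<lambda>(z, w). cmod (z - w)) ` (?Z \<times> ?Z)" by auto
  ultimately have "finite ?S" by (rule rev_finite_subset)
  moreover have "coeff Q 3 \<noteq> 0" using assms(2) by (metis degree_0 leading_coeff_0_iff zero_neq_numeral)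
  then have "?S \<noteq> {}"
    using irreducible_cubic_two_roots[of "coeff Q 0" "coeff Q 1" "coeff Q 2" "coeff Q 3"] assms(1)
    unfolding degree_3_eq_pCons[OF assms(2), symmetric] by blast
  ultimately have "root_sep Q \<in> ?S" unfolding root_sep_def by (rule Min_in)
  then show ?thesis using that by blast
qed

lemma root_sep_cubic_lower_bound:
  assumes "hall_conjecture \<epsilon>" "\<epsilon> > 0"
  shows "\<exists>c>0. \<forall>Q :: int poly. \<forall>A B :: real.
         irreducible Q \<longrightarrow> degree Q = 3 \<longrightarrow>
         B = real_of_int \<bar>lead_coeff Q\<bar> \<longrightarrow> A = real_of_int (naive_height Q) / B \<longrightarrow>
         root_sep Q \<ge> c / (B powr (2 + 1/2 + \<epsilon>) * A powr (2 - 1/2 + \<epsilon>))"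
proof -
  obtain c' where c': "c' > 0" "effective_hall \<epsilon> c'"
    using hall_conjecture_imp_effective_hall[OF assms(1)] by blast
  have "root_sep Q \<ge> c' / 400 / (B powr (2 + 1/2 + \<epsilon>) * A powr (2 - 1/2 + \<epsilon>))"
    if Q: "irreducible Q" "degree Q = 3" and B: "B = real_of_int \<bar>lead_coeff Q\<bar>"
      and A: "A = real_of_int (naive_height Q) / B" for Q A B
  proof -
    define d c b a where "d = coeff Q 0" and "c = coeff Q 1" and "b = coeff Q 2" and "a = coeff Q 3"
    have eq: "Q = [:d, c, b, a:]"
      using degree_3_eq_pCons[OF Q(2)] unfolding a_def b_def c_def d_def .
    obtain z w where zw: "z \<noteq> w" "ipoly Q z = 0" "ipoly Q w = 0" "root_sep Q = cmod (z - w)"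
      using root_sep_attained[OF Q] .
    have "a \<noteq> 0" using Q(2) unfolding a_def by (metis degree_0 leading_coeff_0_iff zero_neq_numeral)
    moreover have "B = real_of_int \<bar>a\<bar>" using B Q(2) by (simp add: a_def)
    moreover have "\<bar>a\<bar> \<le> naive_height Q" "\<bar>b\<bar> \<le> naive_height Q" "\<bar>c\<bar> \<le> naive_height Q"
      "\<bar>d\<bar> \<le> naive_height Q"
      unfolding a_def b_def c_def d_def by (rule abs_coeff_le_naive_height)+
    ultimately show ?thesis
      using irreducible_cubic_sep[OF _ _ _ _ _ _ zw(1) _ _ c'(2,1) assms(2) _ A, of d c b a] Q(1) zw(2,3)
      unfolding zw(4) eq[symmetric] by blast
  qed
  then show ?thesis using c'(1) by (intro exI[of _ "c' / 400"]) auto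
qed

subsection \<open>Rational approximation to a cubic irrational\<close>

text \<open>The cofactor of the root is \<open>a s^2 + e s + l\<close> in
  \<open>s = x - \<xi>\<close>, so the discriminant factors as
  \<open>l^2 * (e^2 - 4 * a * l)\<close>. As it is at least 1 in absolute value, the derivative
  \<open>l\<close> cannot be much smaller than \<open>1 / h\<close>.\<close>

lemma cubic_root_local_bounds:
  fixes a b c d \<xi> h :: real
  defines "e \<equiv> 3 * a * \<xi> + b" and "l \<equiv> 3 * a * \<xi> ^ 2 + 2 * b * \<xi> + c"
  assumes a: "\<bar>a\<bar> \<ge> 1" and h: "\<bar>a\<bar> \<le> h" "\<bar>b\<bar> \<le> h" "\<bar>c\<bar> \<le> h" "\<bar>d\<bar> \<le> h"
    and root: "a * \<xi> ^ 3 + b * \<xi> ^ 2 + c * \<xi> + d = 0" and disc: "\<bar>cubic_disc a b c d\<bar> \<ge> 1"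
  shows "\<bar>e\<bar> \<le> 7 * h" "\<bar>l\<bar> \<le> 17 * h ^ 2" "1 \<le> 11 * h * \<bar>l\<bar>"
proof -
  have h1: "h \<ge> 1" using a h by linarith
  have "norm a * norm \<xi> \<le> 2 * h"
    using a h root by (intro cubic_root_bound[of _ _ b c d]) auto
  then have ax: "\<bar>a * \<xi>\<bar> \<le> 2 * h" by (simp add: abs_mult)
  show e: "\<bar>e\<bar> \<le> 7 * h" unfolding e_def using ax h by linarith
  have sq: "\<bar>x * y\<bar> \<le> k * m * h ^ 2" if "\<bar>x\<bar> \<le> k * h" "\<bar>y\<bar> \<le> m * h" "k \<ge> 0" for x y k m :: real
    using mult_mono[OF that(1,2)] that(3) h1 by (simp add: abs_mult power2_eq_square mult_ac)
  have "a * l = 3 * (a * \<xi> * (a * \<xi>)) + 2 * (b * (a * \<xi>)) + a * c"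
    unfolding l_def by algebra
  moreover have "\<bar>a * \<xi> * (a * \<xi>)\<bar> \<le> 2 * 2 * h ^ 2" "\<bar>b * (a * \<xi>)\<bar> \<le> 1 * 2 * h ^ 2"
    "\<bar>a * c\<bar> \<le> 1 * 1 * h ^ 2"
    using sq[OF ax ax] sq[of b 1 "a * \<xi>" 2] sq[of a 1 c 1] ax h by simp_all
  ultimately have al: "\<bar>a * l\<bar> \<le> 17 * h ^ 2" by linarith
  have "1 * \<bar>l\<bar> \<le> \<bar>a\<bar> * \<bar>l\<bar>" using a by (intro mult_right_mono) auto
  then show "\<bar>l\<bar> \<le> 17 * h ^ 2" using al by (simp add: abs_mult)
  have "\<bar>e * e\<bar> \<le> 7 * 7 * h ^ 2" using sq[OF e e] by simp
  \<comment> \<open>The sum 49 + 4 * 17 = 117 is rounded up to the square of 11.\<close>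
  then have *: "\<bar>e * e - 4 * (a * l)\<bar> \<le> 121 * h ^ 2" using al zero_le_power2[of h] by linarith
  have d: "d = - (a * \<xi> ^ 3 + b * \<xi> ^ 2 + c * \<xi>)" using root by linarith
  have "cubic_disc a b c d = l ^ 2 * (e * e - 4 * (a * l))"
    unfolding cubic_disc_def e_def l_def d by algebra
  then have "1 \<le> l ^ 2 * \<bar>e * e - 4 * (a * l)\<bar>" using disc by (simp add: abs_mult)
  also have "\<dots> \<le> l ^ 2 * (121 * h ^ 2)" using * by (intro mult_left_mono) auto
  also have "\<dots> = (11 * h * \<bar>l\<bar>) ^ 2" by (simp add: power_mult_distrib mult_ac)
  finally show "1 \<le> 11 * h * \<bar>l\<bar>" using h1 power2_le_imp_le[of 1 "11 * h * \<bar>l\<bar>"] by simp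
qed

text \<open>Taylor expansion at \<open>\<xi>\<close> with \<open>s = t - \<xi>\<close>: both the
  form and the Hessian are governed by \<open>l\<close> once \<open>e * s\<close> and
  \<open>a * s^2\<close> are small fractions of \<open>l\<close>.\<close>

lemma cubic_near_root:
  fixes a b c d \<xi> h t :: real
  defines "l \<equiv> 3 * a * \<xi> ^ 2 + 2 * b * \<xi> + c"
  assumes a: "\<bar>a\<bar> \<ge> 1" and h: "\<bar>a\<bar> \<le> h" "\<bar>b\<bar> \<le> h" "\<bar>c\<bar> \<le> h" "\<bar>d\<bar> \<le> h"
    and root: "a * \<xi> ^ 3 + b * \<xi> ^ 2 + c * \<xi> + d = 0" and disc: "\<bar>cubic_disc a b c d\<bar> \<ge> 1"
    and near: "400 * \<bar>\<xi> - t\<bar> * h ^ 2 \<le> 1"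
  shows "\<bar>cubic_form a b c d t 1\<bar> \<le> 2 * \<bar>\<xi> - t\<bar> * \<bar>l\<bar>" "cubic_hess a b c d t 1 \<ge> l ^ 2 / 2"
proof -
  define e s where "e = 3 * a * \<xi> + b" and "s = t - \<xi>"
  have e: "\<bar>e\<bar> \<le> 7 * h" and l: "1 \<le> 11 * h * \<bar>l\<bar>"
    using cubic_root_local_bounds[OF a h root disc] unfolding e_def l_def by auto
  have h1: "h \<ge> 1" using a h by linarith
  have s: "400 * \<bar>s\<bar> * h ^ 2 \<le> 1" using near by (simp add: s_def abs_minus_commute)
  \<comment> \<open>The closeness assumption is combined with the lower bound for \<open>l\<close>,
    so that smallness is measured against \<open>l\<close> and not against 1.\<close>
  have sh: "400 * \<bar>s\<bar> * h \<le> 11 * \<bar>l\<bar>"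
  proof -
    have "(400 * \<bar>s\<bar> * h) * h \<le> 1" using s by (simp add: power2_eq_square mult_ac)
    also have "\<dots> \<le> (11 * \<bar>l\<bar>) * h" using l by (simp add: mult_ac)
    finally show ?thesis using h1 by simp
  qed
  have es: "\<bar>e * s\<bar> \<le> \<bar>l\<bar> / 4"
  proof -
    have "\<bar>e * s\<bar> \<le> 7 * h * \<bar>s\<bar>" unfolding abs_mult using e by (intro mult_right_mono) auto
    then show ?thesis using sh by (simp add: mult_ac)
  qed
  have as: "\<bar>a * s ^ 2\<bar> \<le> \<bar>l\<bar> / 36"
  proof -
    have "400 * \<bar>s\<bar> * 1 \<le> 400 * \<bar>s\<bar> * h ^ 2" using h1 by (intro mult_left_mono) auto
    then have s1: "\<bar>s\<bar> \<le> 1 / 400" using s by linarith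
    have "\<bar>a * s ^ 2\<bar> = (\<bar>a\<bar> * \<bar>s\<bar>) * \<bar>s\<bar>" by (simp add: abs_mult power2_eq_square)
    also have "\<dots> \<le> (h * \<bar>s\<bar>) * (1 / 400)" using s1 h h1 by (intro mult_mono) auto
    finally show ?thesis using sh by (simp add: mult_ac)
  qed
  have d: "d = - (a * \<xi> ^ 3 + b * \<xi> ^ 2 + c * \<xi>)" using root by linarith
  have t: "t = \<xi> + s" by (simp add: s_def)
  have "cubic_form a b c d t 1 = s * (l + e * s + a * s ^ 2)"
    unfolding cubic_form_def l_def e_def d t power_one mult_1_right by algebra
  then have "\<bar>cubic_form a b c d t 1\<bar> = \<bar>s\<bar> * \<bar>l + e * s + a * s ^ 2\<bar>" by (simp add: abs_mult)
  also have "\<dots> \<le> \<bar>s\<bar> * (2 * \<bar>l\<bar>)" using es as by (intro mult_left_mono) linarith+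
  finally show "\<bar>cubic_form a b c d t 1\<bar> \<le> 2 * \<bar>\<xi> - t\<bar> * \<bar>l\<bar>"
    by (simp add: s_def abs_minus_commute mult_ac)
  have "cubic_hess a b c d t 1 = l ^ 2 + l * (e * s) + (e * s) ^ 2 - 3 * (l * (a * s ^ 2))"
    unfolding cubic_hess_def l_def e_def d t power_one mult_1_right by algebra
  moreover have "\<bar>l * (e * s)\<bar> \<le> \<bar>l\<bar> * (\<bar>l\<bar> / 4)"
    unfolding abs_mult[of l] using es by (intro mult_left_mono) auto
  moreover have "\<bar>l * (a * s ^ 2)\<bar> \<le> \<bar>l\<bar> * (\<bar>l\<bar> / 36)"
    unfolding abs_mult[of l] using as by (intro mult_left_mono) auto
  moreover have "\<bar>l\<bar> * (\<bar>l\<bar> / 4) = l ^ 2 / 4" "\<bar>l\<bar> * (\<bar>l\<bar> / 36) = l ^ 2 / 36"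
    by (simp_all add: power2_eq_square)
  ultimately show "cubic_hess a b c d t 1 \<ge> l ^ 2 / 2"
    using zero_le_power2[of "e * s"] zero_le_power2[of l] by linarith
qed

text \<open>The coefficients add up to 1 + 4 + 4 + 27 + 18 = 54.\<close>

lemma abs_cubic_disc_le:
  fixes a b c d h :: real
  assumes "\<bar>a\<bar> \<le> h" "\<bar>b\<bar> \<le> h" "\<bar>c\<bar> \<le> h" "\<bar>d\<bar> \<le> h"
  shows "\<bar>cubic_disc a b c d\<bar> \<le> 54 * h ^ 4"
proof -
  have h0: "h \<ge> 0" using assms(1) by linarith
  have prod: "\<bar>x * y * z * w\<bar> \<le> h ^ 4" if "\<bar>x\<bar> \<le> h" "\<bar>y\<bar> \<le> h" "\<bar>z\<bar> \<le> h" "\<bar>w\<bar> \<le> h" for x y z w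
  proof -
    have "\<bar>x\<bar> * \<bar>y\<bar> * \<bar>z\<bar> * \<bar>w\<bar> \<le> h * h * h * h"
      using that h0 by (intro mult_mono mult_nonneg_nonneg) auto
    then show ?thesis by (simp add: abs_mult power4_eq_xxxx)
  qed
  have "cubic_disc a b c d = b * b * c * c - 4 * (a * c * c * c) - 4 * (b * b * b * d)
      - 27 * (a * a * d * d) + 18 * (a * b * c * d)"
    unfolding cubic_disc_def by algebra
  moreover have "\<bar>b * b * c * c\<bar> \<le> h ^ 4" "\<bar>a * c * c * c\<bar> \<le> h ^ 4" "\<bar>b * b * b * d\<bar> \<le> h ^ 4"
    "\<bar>a * a * d * d\<bar> \<le> h ^ 4" "\<bar>a * b * c * d\<bar> \<le> h ^ 4"
    by (intro prod assms)+
  ultimately show ?thesis by linarith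
qed

section \<open>One real root of an irreducible cubic and one rational point\<close>

locale cubic_approx =
  fixes a b c d h p q :: int and \<xi> :: real
  assumes irr: "irreducible [:d, c, b, a:]" and a: "a \<noteq> 0"
    and h: "\<bar>a\<bar> \<le> h" "\<bar>b\<bar> \<le> h" "\<bar>c\<bar> \<le> h" "\<bar>d\<bar> \<le> h"
    and root: "ipoly [:d, c, b, a:] \<xi> = 0" and q: "q \<ge> 1"
begin

definition "dist_to_root = \<bar>\<xi> - real_of_int p / real_of_int q\<bar>"
definition "deriv_at_root = \<bar>3 * real_of_int a * \<xi> ^ 2 + 2 * real_of_int b * \<xi> + real_of_int c\<bar>"
definition "hall_x = 4 * cubic_hess a b c d p q"
definition "hall_y = 4 * cubic_covar a b c d p q"

lemma h_ge_1: "h \<ge> 1" using a h by linarith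

lemma real_bounds:
  "\<bar>real_of_int a\<bar> \<ge> 1" "\<bar>real_of_int a\<bar> \<le> real_of_int h" "\<bar>real_of_int b\<bar> \<le> real_of_int h"
  "\<bar>real_of_int c\<bar> \<le> real_of_int h" "\<bar>real_of_int d\<bar> \<le> real_of_int h"
  using a h by linarith+

lemma real_root: "real_of_int a * \<xi> ^ 3 + real_of_int b * \<xi> ^ 2 + real_of_int c * \<xi> + real_of_int d = 0"
  using root unfolding ipoly_cubic .

lemma disc_ge_1: "1 \<le> \<bar>cubic_disc (real_of_int a) (real_of_int b) (real_of_int c) (real_of_int d)\<bar>"
proof -
  have "1 \<le> \<bar>cubic_disc a b c d\<bar>" using irreducible_cubic_disc_nonzero[OF irr a] by linarith
  then have "1 \<le> real_of_int \<bar>cubic_disc a b c d\<bar>" by linarith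
  then show ?thesis unfolding of_int_abs of_int_cubic_disc .
qed

lemma deriv_at_root_bounds:
  "deriv_at_root \<le> 17 * real_of_int h ^ 2" "1 \<le> 11 * real_of_int h * deriv_at_root"
  using cubic_root_local_bounds(2,3)[OF real_bounds real_root disc_ge_1]
  unfolding deriv_at_root_def by auto

lemma deriv_at_root_pos: "deriv_at_root > 0"
  using deriv_at_root_bounds(2) by (cases "deriv_at_root = 0") (auto simp: deriv_at_root_def)

lemma form_ge_1: "1 \<le> \<bar>real_of_int (cubic_form a b c d p q)\<bar>"
  using irreducible_cubic_form_nonzero[OF irr a, of q p] q by linarith

lemma hall_ne: "hall_x ^ 3 \<noteq> hall_y ^ 2"
proof -
  have "cubic_disc a b c d \<noteq> 0" "cubic_form a b c d p q \<noteq> 0"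
    using irreducible_cubic_disc_nonzero[OF irr a] irreducible_cubic_form_nonzero[OF irr a] q by auto
  then have "hall_x ^ 3 - hall_y ^ 2 \<noteq> 0" unfolding hall_x_def hall_y_def cubic_syzygy by simp
  then show ?thesis by simp
qed

section \<open>Points close enough to the root for the Taylor estimates\<close>

context
  assumes near: "400 * dist_to_root * real_of_int h ^ 2 \<le> 1"
begin

text \<open>By homogeneity the form at \<open>(p, q)\<close> is \<open>q^3\<close> times its value
  at \<open>(p / q, 1)\<close>; the Hessian in \<open>hall_x_ge\<close> scales by
  \<open>q^2\<close>.\<close>

lemma form_le:
  "\<bar>real_of_int (cubic_form a b c d p q)\<bar> \<le> 2 * real_of_int q ^ 3 * dist_to_root * deriv_at_root"
proof -
  let ?f = "cubic_form (real_of_int a) b c d (real_of_int p / real_of_int q) 1"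
  have "real_of_int (cubic_form a b c d p q) = real_of_int q ^ 3 * ?f"
    using q by (simp add: cubic_form_def field_simps power2_eq_square power3_eq_cube)
  then have "\<bar>real_of_int (cubic_form a b c d p q)\<bar> = real_of_int q ^ 3 * \<bar>?f\<bar>"
    using q by (simp add: abs_mult)
  moreover have "\<bar>?f\<bar> \<le> 2 * dist_to_root * deriv_at_root"
    using cubic_near_root(1)[OF real_bounds real_root disc_ge_1, of "real_of_int p / real_of_int q"] near
    unfolding dist_to_root_def deriv_at_root_def by simp
  then have "real_of_int q ^ 3 * \<bar>?f\<bar> \<le> real_of_int q ^ 3 * (2 * dist_to_root * deriv_at_root)"
    using q by (intro mult_left_mono) auto
  ultimately show ?thesis by (simp add: mult_ac)
qed

lemma hall_x_ge: "(real_of_int q * deriv_at_root) ^ 2 \<le> real_of_int hall_x"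
proof -
  let ?f = "cubic_hess (real_of_int a) b c d (real_of_int p / real_of_int q) 1"
  have "real_of_int hall_x = 4 * (real_of_int q ^ 2 * ?f)"
    using q by (simp add: hall_x_def cubic_hess_def field_simps power2_eq_square)
  moreover have "?f \<ge> deriv_at_root ^ 2 / 2"
    using cubic_near_root(2)[OF real_bounds real_root disc_ge_1, of "real_of_int p / real_of_int q"] near
    unfolding dist_to_root_def deriv_at_root_def by simp
  then have "real_of_int q ^ 2 * ?f \<ge> real_of_int q ^ 2 * (deriv_at_root ^ 2 / 2)"
    by (intro mult_left_mono) auto
  ultimately have "real_of_int hall_x \<ge> 2 * (real_of_int q ^ 2 * deriv_at_root ^ 2)" by linarith
  moreover have "real_of_int q ^ 2 * deriv_at_root ^ 2 \<ge> 0" by simp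
  ultimately show ?thesis unfolding power_mult_distrib by linarith
qed

lemma dist_to_root_pos: "dist_to_root > 0"
  using form_ge_1 form_le by (cases "dist_to_root = 0") (auto simp: dist_to_root_def)

text \<open>The nonzero integer \<open>F(p, q)\<close> is at least 1 in absolute value; 34 is 2 *
  17.\<close>

lemma liouville_bound: "1 \<le> 34 * dist_to_root * real_of_int h ^ 2 * real_of_int q ^ 3"
proof -
  have "1 \<le> 2 * real_of_int q ^ 3 * dist_to_root * deriv_at_root" using form_ge_1 form_le by linarith
  also have "\<dots> \<le> 2 * real_of_int q ^ 3 * dist_to_root * (17 * real_of_int h ^ 2)"
    using q dist_to_root_pos deriv_at_root_bounds by (intro mult_left_mono) auto
  finally show ?thesis by (simp add: mult_ac)
qed

text \<open>Hall's inequality compares \<open>(Q * L) powr (1 - 2 * \<epsilon>)\<close> with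
  \<open>D * F^2\<close>. After cancellation a factor \<open>L powr (1 + 2 * \<epsilon>)\<close>
  remains, and \<open>L \<le> 17 * H^2\<close> turns it into a power of the height.\<close>

lemma hall_bound:
  assumes c': "0 < c'" "c' \<le> 1" and eps: "0 < \<epsilon>" "\<epsilon> \<le> 1/2"
    and hall: "c' * real_of_int \<bar>hall_x\<bar> powr (1/2 - \<epsilon>) \<le> real_of_int \<bar>hall_x ^ 3 - hall_y ^ 2\<bar>"
  shows "c' \<le> 5200 * dist_to_root * real_of_int h powr (3 + 2 * \<epsilon>) * real_of_int q powr (5/2 + \<epsilon>)"
proof -
  define L s H where "L = deriv_at_root" and "s = dist_to_root" and "H = real_of_int h"
  define Q where "Q = real_of_int q"
  have L0: "L > 0" using deriv_at_root_pos by (simp add: L_def)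
  have s0: "s > 0" using dist_to_root_pos by (simp add: s_def)
  have H1: "H \<ge> 1" using h_ge_1 by (simp add: H_def)
  have Q1: "Q \<ge> 1" using q by (simp add: Q_def)
  have LH: "L \<le> 17 * H ^ 2" using deriv_at_root_bounds(1) by (simp add: L_def H_def)
  have "\<bar>hall_x ^ 3 - hall_y ^ 2\<bar> = 432 * \<bar>cubic_disc a b c d\<bar> * (cubic_form a b c d p q) ^ 2"
    unfolding hall_x_def hall_y_def cubic_syzygy by (simp add: abs_mult)
  then have "real_of_int \<bar>hall_x ^ 3 - hall_y ^ 2\<bar>
      = 432 * (\<bar>cubic_disc (real_of_int a) b c d\<bar> * \<bar>real_of_int (cubic_form a b c d p q)\<bar> ^ 2)"
    by (simp flip: of_int_cubic_disc)
  also have "\<dots> \<le> 432 * ((54 * H ^ 4) * (2 * Q ^ 3 * s * L) ^ 2)"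
    using abs_cubic_disc_le[OF real_bounds(2-5)] form_le
    by (intro mult_left_mono mult_mono power_mono) (auto simp: H_def Q_def s_def L_def)
  finally have up: "real_of_int \<bar>hall_x ^ 3 - hall_y ^ 2\<bar> \<le> 93312 * H ^ 4 * s ^ 2 * (Q ^ 6 * L ^ 2)"
    by (simp add: power_mult_distrib mult_ac flip: power_mult)
  define k where "k = 1/2 - \<epsilon>"
  have "((Q * L) ^ 2) powr k \<le> real_of_int \<bar>hall_x\<bar> powr k"
    using hall_x_ge eps by (intro powr_mono2) (auto simp: Q_def L_def k_def)
  also have "((Q * L) ^ 2) powr k = (Q * L) powr (2 * k)"
    using Q1 L0 by (simp add: powr_powr flip: powr_numeral)
  also have "\<dots> = Q powr (2 * k) * L powr (2 * k)" using Q1 L0 by (simp add: powr_mult)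
  finally have "c' * (Q powr (2 * k) * L powr (2 * k)) \<le> c' * real_of_int \<bar>hall_x\<bar> powr k"
    using c' by (intro mult_left_mono) auto
  also have "\<dots> \<le> 93312 * H ^ 4 * s ^ 2 * (Q ^ 6 * L ^ 2)" using hall up by (simp add: k_def)
  also have "Q ^ 6 = Q powr (2 * k) * Q powr (5 + 2 * \<epsilon>)"
    using Q1 by (simp add: k_def powr_add[symmetric])
  also have "L ^ 2 = L powr (2 * k) * L powr (1 + 2 * \<epsilon>)"
    using L0 by (simp add: k_def powr_add[symmetric])
  also have "93312 * H ^ 4 * s ^ 2 * (Q powr (2 * k) * Q powr (5 + 2 * \<epsilon>) * (L powr (2 * k) * L powr (1 + 2 * \<epsilon>)))
    = (93312 * H ^ 4 * s ^ 2 * Q powr (5 + 2 * \<epsilon>) * L powr (1 + 2 * \<epsilon>)) * (Q powr (2 * k) * L powr (2 * k))"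
    by simp
  finally have "c' \<le> 93312 * H ^ 4 * s ^ 2 * Q powr (5 + 2 * \<epsilon>) * L powr (1 + 2 * \<epsilon>)"
    using Q1 L0 by (simp add: mult_le_cancel_right)
  also have "\<dots> \<le> 93312 * H ^ 4 * s ^ 2 * Q powr (5 + 2 * \<epsilon>) * (289 * H powr (2 + 4 * \<epsilon>))"
  proof (intro mult_left_mono)
    have "L powr (1 + 2 * \<epsilon>) \<le> (17 * H ^ 2) powr (1 + 2 * \<epsilon>)"
      using L0 LH eps by (intro powr_mono2) auto
    also have "\<dots> = 17 powr (1 + 2 * \<epsilon>) * (H ^ 2) powr (1 + 2 * \<epsilon>)" by (simp add: powr_mult)
    also have "\<dots> \<le> 289 * (H ^ 2) powr (1 + 2 * \<epsilon>)"
      using eps powr_mono[of "1 + 2 * \<epsilon>" 2 17] by (intro mult_right_mono) auto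
    also have "(H ^ 2) powr (1 + 2 * \<epsilon>) = H powr (2 * (1 + 2 * \<epsilon>))"
      using H1 by (simp add: powr_powr flip: powr_numeral)
    finally show "L powr (1 + 2 * \<epsilon>) \<le> 289 * H powr (2 + 4 * \<epsilon>)" by simp
  qed auto
  also have "\<dots> = 26967168 * (s * H powr (3 + 2 * \<epsilon>) * Q powr (5/2 + \<epsilon>)) ^ 2"
  proof -
    have "H ^ 4 * H powr (2 + 4 * \<epsilon>) = (H powr (3 + 2 * \<epsilon>)) ^ 2"
      using H1 by (simp add: power2_eq_square powr_add[symmetric] flip: powr_numeral)
    moreover have "Q powr (5 + 2 * \<epsilon>) = (Q powr (5/2 + \<epsilon>)) ^ 2"
      by (simp add: power2_eq_square powr_add[symmetric])
    ultimately show ?thesis by (simp add: power_mult_distrib mult_ac)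
  qed
  finally have *: "c' \<le> 26967168 * (s * H powr (3 + 2 * \<epsilon>) * Q powr (5/2 + \<epsilon>)) ^ 2" .
  let ?Y = "s * H powr (3 + 2 * \<epsilon>) * Q powr (5/2 + \<epsilon>)"
  \<comment> \<open>5200 is the square root of 26967168 rounded up.\<close>
  have "c' ^ 2 \<le> c'" using c' by (simp add: power2_eq_square mult_left_le)
  also have "\<dots> \<le> 26967168 * ?Y ^ 2" by (rule *)
  also have "\<dots> \<le> 27040000 * ?Y ^ 2" by (intro mult_right_mono) auto
  also have "\<dots> = (5200 * ?Y) ^ 2" by (simp add: power_mult_distrib)
  finally have "c' \<le> 5200 * ?Y" using s0 by (intro power2_le_imp_le[of c']) auto
  then show ?thesis by (simp add: s_def H_def Q_def mult_ac)
qed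

end

text \<open>Both bounds are raised to the weights \<open>1 - \<theta>\<close> and
  \<open>\<theta>\<close> and multiplied; the exponents \<open>u\<close> and \<open>v\<close> are
  affine in \<open>\<theta>\<close>.\<close>

lemma approximation_bound:
  assumes c': "0 < c'" "c' \<le> 1" and eps: "0 < \<epsilon>" and r: "1/2 + \<epsilon> \<le> r" "r \<le> 1"
    and u: "u = 2 * r + 2 * (1 - r) / (1/2 - \<epsilon>)" and v: "v = 2 + r"
    and hall: "400 * dist_to_root * real_of_int h ^ 2 \<le> 1 \<Longrightarrow>
      c' * real_of_int \<bar>hall_x\<bar> powr (1/2 - \<epsilon>) \<le> real_of_int \<bar>hall_x ^ 3 - hall_y ^ 2\<bar>"
  shows "c' \<le> 5200 * dist_to_root * real_of_int h powr u * real_of_int q powr v"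
proof -
  define s H Q where "s = dist_to_root" and "H = real_of_int h" and "Q = real_of_int q"
  have H1: "H \<ge> 1" using h_ge_1 by (simp add: H_def)
  have Q1: "Q \<ge> 1" using q by (simp add: Q_def)
  define \<theta> where "\<theta> = (1 - r) / (1/2 - \<epsilon>)"
  have eps2: "\<epsilon> \<le> 1/2" using r by linarith
  have \<theta>: "0 \<le> \<theta>" "\<theta> \<le> 1" unfolding \<theta>_def using r eps2 by (auto simp: divide_le_eq_1)
  \<comment> \<open>If \<open>\<epsilon> = 1/2\<close> then \<open>r = 1\<close>, and division by
    zero yields \<open>\<theta> = 0\<close>, which is the pure Liouville case.\<close>
  have \<theta>r: "\<theta> * (1/2 - \<epsilon>) = 1 - r" using r by (cases "\<epsilon> = 1/2") (auto simp: \<theta>_def)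
  have u': "u = 2 * (1 - \<theta>) + (3 + 2 * \<epsilon>) * \<theta>"
  proof -
    have "u = 2 * r + 2 * \<theta>" unfolding u \<theta>_def by simp
    also have "\<dots> = 2 * (1 - \<theta>) + (3 + 2 * \<epsilon>) * \<theta>" using \<theta>r by (simp add: algebra_simps)
    finally show ?thesis .
  qed
  have v': "v = 3 * (1 - \<theta>) + (5/2 + \<epsilon>) * \<theta>" using \<theta>r unfolding v by (simp add: algebra_simps)
  have "2 * \<theta> \<le> (3 + 2 * \<epsilon>) * \<theta>" using \<theta> eps by (intro mult_right_mono) auto
  then have u2: "u \<ge> 2" unfolding u' by (simp add: algebra_simps)
  have v2: "v \<ge> 0" using r eps v by linarith
  have s0: "s \<ge> 0" by (simp add: s_def dist_to_root_def)
  show ?thesis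
  proof (cases "400 * dist_to_root * real_of_int h ^ 2 \<le> 1")
    case near: True
    have s0: "s > 0" using dist_to_root_pos[OF near] by (simp add: s_def)
    define k where "k = 5200 * s / c'"
    have k0: "k > 0" using s0 c' by (simp add: k_def)
    have "1 \<le> 34 * s * H ^ 2 * Q ^ 3"
      using liouville_bound[OF near] by (simp add: s_def H_def Q_def)
    moreover have "34 * (s * H ^ 2 * Q ^ 3) \<le> 5200 * (s * H ^ 2 * Q ^ 3)"
      using s0 H1 Q1 by (intro mult_right_mono) auto
    ultimately have "c' \<le> 5200 * s * H ^ 2 * Q ^ 3" using c' by linarith
    then have 1: "1 \<le> k * H powr 2 * Q powr 3" using c' H1 Q1 by (simp add: k_def field_simps)
    have "c' \<le> 5200 * s * H powr (3 + 2 * \<epsilon>) * Q powr (5/2 + \<epsilon>)"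
      using hall_bound[OF near c' eps eps2 hall[OF near]] by (simp add: s_def H_def Q_def)
    then have 2: "1 \<le> k * H powr (3 + 2 * \<epsilon>) * Q powr (5/2 + \<epsilon>)" using c' by (simp add: k_def field_simps)
    have "1 * 1 \<le> (k * H powr 2 * Q powr 3) powr (1 - \<theta>)
        * (k * H powr (3 + 2 * \<epsilon>) * Q powr (5/2 + \<epsilon>)) powr \<theta>"
      using ge_one_powr_ge_zero[OF 1] ge_one_powr_ge_zero[OF 2] \<theta> by (intro mult_mono) auto
    also have "\<dots> = (k powr (1 - \<theta>) * k powr \<theta>) * (H powr (2 * (1 - \<theta>)) * H powr ((3 + 2 * \<epsilon>) * \<theta>))
        * (Q powr (3 * (1 - \<theta>)) * Q powr ((5/2 + \<epsilon>) * \<theta>))"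
      using k0 by (simp only: powr_mult powr_powr mult_ac)
    also have "\<dots> = k * H powr u * Q powr v"
      unfolding u' v' using k0 by (simp add: powr_add[symmetric])
    finally show ?thesis using c' by (simp add: k_def field_simps s_def H_def Q_def)
  next
    \<comment> \<open>Far from the root the distance exceeds \<open>1 / (400 * H^2)\<close>, which
      is enough because \<open>u \<ge> 2\<close> and \<open>v \<ge> 0\<close>.\<close>
    case False
    then have "1 < 400 * s * H ^ 2" by (simp add: s_def H_def)
    also have "400 * s * H ^ 2 \<le> 400 * s * (H powr u * Q powr v)"
    proof (intro mult_left_mono)
      have "H ^ 2 \<le> H powr u" using H1 u2 powr_mono[of 2 u H] by simp
      moreover have "1 \<le> Q powr v" using Q1 v2 by (simp add: ge_one_powr_ge_zero)
      ultimately show "H ^ 2 \<le> H powr u * Q powr v" using mult_mono[of "H ^ 2" "H powr u" 1 "Q powr v"] by simp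
    qed (use s0 in auto)
    also have "\<dots> \<le> 5200 * (s * (H powr u * Q powr v))"
      using s0 by simp
    finally show ?thesis using c' by (simp add: s_def H_def Q_def mult_ac)
  qed
qed

text \<open>The bounds depend on \<open>M\<close> alone, so an approximation this good whose Hall
  pair is exceptional comes from a finite supply.\<close>

lemma exceptional_bounds:
  assumes uv: "u \<ge> 2" "v \<ge> 2" and M: "M \<ge> 1" "real_of_int \<bar>hall_x\<bar> \<le> M"
    and small: "5200 * dist_to_root * real_of_int h powr u * real_of_int q powr v < 1"
  shows "real_of_int h \<le> 2 * M" "real_of_int q \<le> 22 * M ^ 2" "dist_to_root \<le> 1"
proof -
  define s H Q L where "s = dist_to_root" and "H = real_of_int h" and "Q = real_of_int q"
    and "L = deriv_at_root"
  have H1: "H \<ge> 1" using h_ge_1 by (simp add: H_def)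
  have Q1: "Q \<ge> 1" using q by (simp add: Q_def)
  have L0: "L > 0" using deriv_at_root_pos by (simp add: L_def)
  have s0: "s \<ge> 0" by (simp add: s_def dist_to_root_def)
  have HQ: "H ^ 2 * Q ^ 2 \<le> H powr u * Q powr v"
    using H1 Q1 uv powr_mono[of 2 u H] powr_mono[of 2 v Q] by (intro mult_mono) auto
  have "5200 * s * (H ^ 2 * Q ^ 2) \<le> 5200 * s * (H powr u * Q powr v)"
    using HQ s0 by (intro mult_left_mono) auto
  also have "\<dots> < 1" using small by (simp add: s_def H_def Q_def mult_ac)
  finally have sHQ: "5200 * (s * (H ^ 2 * Q ^ 2)) < 1" by simp
  have "s * (H ^ 2 * 1) \<le> s * (H ^ 2 * Q ^ 2)" using s0 Q1 by (intro mult_left_mono) auto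
  moreover have "0 \<le> s * H ^ 2" using s0 by simp
  ultimately have near: "400 * dist_to_root * real_of_int h ^ 2 \<le> 1"
    using sHQ unfolding s_def[symmetric] H_def[symmetric] by simp
  have "(Q * L) ^ 2 \<le> M" using hall_x_ge[OF near] M(2) unfolding Q_def L_def by linarith
  also have "M \<le> M ^ 2" using M(1) by (simp add: power2_eq_square)
  finally have QL: "Q * L \<le> M" using M(1) by (intro power2_le_imp_le[of "Q * L"]) auto
  have "1 \<le> 2 * Q ^ 3 * s * L"
    using form_ge_1 form_le[OF near] unfolding Q_def s_def L_def by linarith
  \<comment> \<open>Multiplying by \<open>H^2\<close> isolates \<open>Q * L\<close>, at most
    \<open>M\<close>, and \<open>s * H^2 * Q^2\<close>, below 1.\<close>
  then have "1 * H ^ 2 \<le> (2 * Q ^ 3 * s * L) * H ^ 2" by (intro mult_right_mono) auto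
  also have "\<dots> = 2 * (Q * L) * (s * (H ^ 2 * Q ^ 2))"
    by (simp add: power2_eq_square power3_eq_cube)
  also have "\<dots> \<le> 2 * M * 1"
    using QL sHQ s0 M(1) Q1 L0 by (intro mult_mono) auto
  finally have "H ^ 2 \<le> 2 * M" by simp
  moreover have "H \<le> H ^ 2" using H1 by (simp add: power2_eq_square)
  ultimately have HM: "H \<le> 2 * M" by linarith
  then show "real_of_int h \<le> 2 * M" by (simp add: H_def)
  have "Q * 1 \<le> Q * (11 * H * L)" using deriv_at_root_bounds(2) Q1 by (intro mult_left_mono) (auto simp: H_def L_def)
  also have "\<dots> = (Q * L) * (11 * H)" by simp
  also have "\<dots> \<le> M * (11 * (2 * M))" using QL HM M H1 by (intro mult_mono) auto
  finally show "real_of_int q \<le> 22 * M ^ 2" by (simp add: Q_def power2_eq_square)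
  have "1 * 1 \<le> H ^ 2 * Q ^ 2" using H1 Q1 by (intro mult_mono) auto
  then have "s * 1 \<le> s * (H ^ 2 * Q ^ 2)" using s0 by (intro mult_left_mono) auto
  then show "dist_to_root \<le> 1" using sHQ s0 unfolding s_def by linarith
qed

end

section \<open>Passage to all real cubic irrationals\<close>

text \<open>The locale predicate has no argument for \<open>p\<close>, so one instance serves every
  numerator.\<close>

lemma real_alg_of_degree_3_cubic_approx:
  assumes "\<xi> \<in> real_alg_of_degree 3" "q \<ge> 1"
  shows "\<exists>a b c d. cubic_approx a b c d (alg_height \<xi>) q \<xi>"
proof -
  define Q where "Q = min_int_poly \<xi>"
  have deg: "degree Q = 3" and alg: "algebraic \<xi>"
    using assms(1) by (auto simp: real_alg_of_degree_def Q_def)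
  have "irreducible Q" "ipoly Q \<xi> = 0"
    unfolding Q_def using algebraic_min_int_poly[OF alg] by auto
  moreover have "coeff Q 3 \<noteq> 0" using deg by (metis degree_0 leading_coeff_0_iff zero_neq_numeral)
  ultimately have "cubic_approx (coeff Q 3) (coeff Q 2) (coeff Q 1) (coeff Q 0) (alg_height \<xi>) q \<xi>"
    unfolding cubic_approx_def degree_3_eq_pCons[OF deg, symmetric] alg_height_def Q_def[symmetric]
    using abs_coeff_le_naive_height assms(2) by blast
  then show ?thesis by blast
qed

lemma effective_hall_approximation:
  assumes "effective_hall \<epsilon> c'" "c' > 0" "\<epsilon> > 0" "1/2 + \<epsilon> \<le> r" "r \<le> 1"
    and "u = 2 * r + 2 * (1 - r) / (1/2 - \<epsilon>)" "v = 2 + r"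
    and \<xi>: "\<xi> \<in> real_alg_of_degree 3" "q \<ge> 1"
  shows "c' \<le> 5200 * \<bar>\<xi> - real_of_int p / real_of_int q\<bar>
    * (real_of_int (alg_height \<xi>) powr u * real_of_int q powr v)"
proof -
  obtain a b c d where "cubic_approx a b c d (alg_height \<xi>) q \<xi>"
    using real_alg_of_degree_3_cubic_approx[OF \<xi>] by blast
  then interpret cubic_approx a b c d "alg_height \<xi>" p q \<xi> .
  have "c' * real_of_int \<bar>hall_x\<bar> powr (1/2 - \<epsilon>) < real_of_int \<bar>hall_x ^ 3 - hall_y ^ 2\<bar>"
    using assms(1) hall_ne unfolding effective_hall_def by blast
  then have "c' \<le> 5200 * dist_to_root * real_of_int (alg_height \<xi>) powr u * real_of_int q powr v"
    using effective_hall_less_1[OF assms(1)] assms(2-7) by (intro approximation_bound) auto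
  then show ?thesis unfolding dist_to_root_def by (simp add: mult.assoc)
qed

text \<open>Northcott finiteness: finitely many coefficient lists, each nonzero polynomial with
  finitely many roots.\<close>

lemma finite_real_alg_of_degree_3_height_le:
  "finite {\<xi> \<in> real_alg_of_degree 3. alg_height \<xi> \<le> N}"
proof -
  let ?P = "{P :: int poly. degree P \<le> 3 \<and> (\<forall>i. \<bar>coeff P i\<bar> \<le> N)}"
  have "?P \<subseteq> Poly ` {xs. set xs \<subseteq> {-N..N} \<and> length xs \<le> 4}"
  proof
    fix P assume P: "P \<in> ?P"
    then have "length (coeffs P) \<le> 4" by (cases "P = 0") (auto simp: length_coeffs_degree)
    moreover have "set (coeffs P) \<subseteq> {-N..N}"
      using P by (auto simp: coeffs_def abs_le_iff) (smt (verit))+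
    moreover have "P = Poly (coeffs P)" by simp
    ultimately show "P \<in> Poly ` {xs. set xs \<subseteq> {-N..N} \<and> length xs \<le> 4}" by blast
  qed
  moreover have "finite {xs. set xs \<subseteq> {-N..N} \<and> length xs \<le> 4}"
    by (intro finite_lists_length_le) simp
  ultimately have "finite ?P" using finite_surj by blast
  then have "finite (\<Union>P\<in>?P - {0}. {x :: real. ipoly P x = 0})"
    by (intro finite_UN_I poly_roots_finite) (auto simp: map_poly_eq_0_iff)
  moreover have "\<xi> \<in> (\<Union>P\<in>?P - {0}. {x :: real. ipoly P x = 0})"
    if \<xi>: "\<xi> \<in> real_alg_of_degree 3" "alg_height \<xi> \<le> N" for \<xi>
  proof -
    have "min_int_poly \<xi> \<in> ?P - {0}" "ipoly (min_int_poly \<xi>) \<xi> = 0"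
      using \<xi> algebraic_min_int_poly[of \<xi>] abs_coeff_le_naive_height[of "min_int_poly \<xi>"]
      by (auto simp: real_alg_of_degree_def alg_height_def intro: order_trans)
    then show ?thesis by blast
  qed
  ultimately show ?thesis by (elim finite_subset[rotated]) blast
qed

text \<open>Since \<open>1/2 - \<epsilon>\<close> is at most 1, the quotient is at least
  \<open>2 * (1 - r)\<close>; for \<open>r = 1\<close> it vanishes whatever the denominator.\<close>

lemma approximation_exponent_ge_2:
  fixes \<epsilon> r :: real
  assumes "\<epsilon> > 0" "1/2 + \<epsilon> \<le> r" "r \<le> 1"
  shows "2 * r + 2 * (1 - r) / (1/2 - \<epsilon>) \<ge> 2"
proof (cases "r = 1")
  case False
  then have "1/2 - \<epsilon> > 0" using assms by linarith
  moreover have "2 * (1 - r) * (1/2 - \<epsilon>) \<le> 2 * (1 - r) * 1"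
    using assms by (intro mult_left_mono) auto
  moreover define w where "w = 2 * (1 - r) / (1/2 - \<epsilon>)"
  ultimately have "2 * (1 - r) \<le> w" by (simp add: le_divide_eq)
  then show ?thesis unfolding w_def[symmetric] by (simp add: algebra_simps)
qed simp

text \<open>Outside the exceptional set Hall's inequality holds with constant 1, so the constant
  5200 does not depend on that set, which may be unknown. This is why the constant in (iii) is
  explicit.\<close>

lemma hall_conjecture_finite_exceptions:
  assumes hall: "hall_conjecture \<epsilon>" and eps: "\<epsilon> > 0" and r: "1/2 + \<epsilon> \<le> r" "r \<le> 1"
    and u: "u = 2 * r + 2 * (1 - r) / (1/2 - \<epsilon>)" and v: "v = 2 + r"
  shows "finite {(\<xi>, real_of_int p / real_of_int q) | (\<xi> :: real) (p :: int) (q :: int).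
    \<xi> \<in> real_alg_of_degree 3 \<and> q \<ge> 1 \<and>
    5200 * \<bar>\<xi> - real_of_int p / real_of_int q\<bar>
      * (real_of_int (alg_height \<xi>) powr u * real_of_int q powr v) < 1}" (is "finite ?S")
proof -
  define E where "E = {(x :: int, y :: int). 0 < \<bar>x ^ 3 - y ^ 2\<bar> \<and>
       real_of_int \<bar>x ^ 3 - y ^ 2\<bar> < real_of_int \<bar>x\<bar> powr (1/2 - \<epsilon>)}"
  have E: "finite E" using hall unfolding hall_conjecture_def E_def .
  define M where "M = 1 + (\<Sum>(x, y)\<in>E. real_of_int \<bar>x\<bar>)"
  have M1: "M \<ge> 1" unfolding M_def by (simp add: sum_nonneg case_prod_beta)
  \<comment> \<open>\<open>N\<close> dominates both the height bound \<open>2 * M\<close> and the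
    denominator bound; \<open>K\<close> then bounds \<open>q * (\<bar>\<xi>\<bar> + 1)\<close>,
    hence the numerator.\<close>
  define N where "N = \<lceil>22 * M ^ 2\<rceil>"
  define K where "K = N * (2 * N + 1)"
  define X where "X = {\<xi> \<in> real_alg_of_degree 3. alg_height \<xi> \<le> N}"
  have key: "alg_height \<xi> \<le> N \<and> q \<le> N \<and> \<bar>p\<bar> \<le> K"
    if \<xi>: "\<xi> \<in> real_alg_of_degree 3" and q: "q \<ge> 1"
      and bad: "5200 * \<bar>\<xi> - real_of_int p / real_of_int q\<bar>
        * (real_of_int (alg_height \<xi>) powr u * real_of_int q powr v) < 1" for \<xi> p q
  proof -
    obtain a b c d where "cubic_approx a b c d (alg_height \<xi>) q \<xi>"
      using real_alg_of_degree_3_cubic_approx[OF \<xi> q] by blast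
    then interpret cubic_approx a b c d "alg_height \<xi>" p q \<xi> .
    let ?h = "alg_height \<xi>"
    have small: "5200 * dist_to_root * real_of_int ?h powr u * real_of_int q powr v < 1"
      using bad by (simp add: dist_to_root_def mult.assoc)
    have "\<not> 1 * real_of_int \<bar>hall_x\<bar> powr (1/2 - \<epsilon>) \<le> real_of_int \<bar>hall_x ^ 3 - hall_y ^ 2\<bar>"
      using approximation_bound[OF _ _ eps r u v, of 1] small by fastforce
    then have in_E: "(hall_x, hall_y) \<in> E" using hall_ne by (simp add: E_def)
    have "(case (hall_x, hall_y) of (x, y) \<Rightarrow> real_of_int \<bar>x\<bar>) \<le> (\<Sum>(x, y)\<in>E. real_of_int \<bar>x\<bar>)"
      by (rule member_le_sum[OF in_E _ E]) auto
    then have xM: "real_of_int \<bar>hall_x\<bar> \<le> M" by (simp add: M_def)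
    have u2: "u \<ge> 2" unfolding u by (rule approximation_exponent_ge_2[OF eps r])
    have v2: "v \<ge> 2" using v r eps by linarith
    note bounds = exceptional_bounds[OF u2 v2 M1 xM small]
    have "1 * M \<le> M * M" using M1 by (intro mult_right_mono) auto
    then have "2 * M \<le> 22 * M ^ 2" using M1 unfolding power2_eq_square by linarith
    then have hN: "?h \<le> N" and qN: "q \<le> N" using bounds unfolding N_def by linarith+
    have "1 * \<bar>\<xi>\<bar> \<le> \<bar>real_of_int a\<bar> * \<bar>\<xi>\<bar>" using real_bounds(1) by (intro mult_right_mono) auto
    also have "\<dots> \<le> 2 * real_of_int ?h"
      using cubic_root_bound[OF _ real_root, of "real_of_int ?h"] real_bounds a by simp
    finally have "\<bar>\<xi>\<bar> \<le> 2 * real_of_int N" using hN by linarith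
    then have "\<bar>real_of_int p / real_of_int q\<bar> \<le> 2 * real_of_int N + 1"
      using bounds(3) unfolding dist_to_root_def by linarith
    then have "\<bar>real_of_int p\<bar> \<le> real_of_int q * (2 * real_of_int N + 1)"
      using q by (simp add: abs_divide divide_le_eq mult.commute)
    also have "\<dots> \<le> real_of_int N * (2 * real_of_int N + 1)"
      using qN q by (intro mult_right_mono) auto
    finally have "real_of_int \<bar>p\<bar> \<le> real_of_int K" by (simp add: K_def)
    then show ?thesis using hN qN by linarith
  qed
  have "?S \<subseteq> (\<lambda>(\<xi>, p, q). (\<xi>, real_of_int p / real_of_int q)) ` (X \<times> {-K..K} \<times> {1..N})"
  proof
    fix z assume "z \<in> ?S"
    then obtain \<xi> p q where z: "z = (\<xi>, real_of_int p / real_of_int q)" "\<xi> \<in> real_alg_of_degree 3" "q \<ge> 1"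
      and "5200 * \<bar>\<xi> - real_of_int p / real_of_int q\<bar>
        * (real_of_int (alg_height \<xi>) powr u * real_of_int q powr v) < 1"
      by blast
    then have "alg_height \<xi> \<le> N \<and> q \<le> N \<and> \<bar>p\<bar> \<le> K" using key by blast
    then have "(\<xi>, p, q) \<in> X \<times> {-K..K} \<times> {1..N}" using z by (auto simp: X_def)
    then show "z \<in> (\<lambda>(\<xi>, p, q). (\<xi>, real_of_int p / real_of_int q)) ` (X \<times> {-K..K} \<times> {1..N})"
      unfolding z(1) by force
  qed
  moreover have "finite X" unfolding X_def by (rule finite_real_alg_of_degree_3_height_le)
  ultimately show ?thesis by (meson finite_SigmaI finite_atLeastAtMost_int finite_imageI finite_subset)
qed

lemma hall_conjecture_imp_D31:
  assumes hall: "hall_conjecture \<epsilon>" and eps: "\<epsilon> > 0" and r: "1/2 + \<epsilon> \<le> r" "r \<le> 1"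
    and u: "u = 2 * r + 2 * (1 - r) / (1/2 - \<epsilon>)" and v: "v = 2 + r"
  shows "(u, v) \<in> D31"
proof -
  obtain c' where c': "c' > 0" "effective_hall \<epsilon> c'"
    using hall_conjecture_imp_effective_hall[OF hall] by blast
  have u0: "u > 0" using approximation_exponent_ge_2[OF eps r] u by linarith
  have v0: "v > 0" using v r eps by linarith
  have "\<bar>\<xi> - \<alpha>\<bar> \<ge> c' / 5200 * real_of_int (alg_height \<xi>) powr (- u) * real_of_int (alg_height \<alpha>) powr (- v)"
    if \<xi>: "\<xi> \<in> real_alg_of_degree 3" and \<alpha>: "\<alpha> \<in> \<rat>" for \<xi> \<alpha>
  proof -
    obtain p q :: int where pq: "q > 0" "coprime p q" "\<alpha> = real_of_int p / real_of_int q"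
      using \<alpha> by (elim Rats_cases') auto
    then have q1: "q \<ge> 1" by simp
    obtain a b c d where "cubic_approx a b c d (alg_height \<xi>) q \<xi>"
      using real_alg_of_degree_3_cubic_approx[OF \<xi> q1] by blast
    then have h1: "alg_height \<xi> \<ge> 1" by (rule cubic_approx.h_ge_1)
    define Z where "Z = real_of_int (alg_height \<xi>) powr u"
    have Z0: "Z > 0" using h1 by (simp add: Z_def)
    have "q \<le> alg_height \<alpha>" using denominator_le_alg_height[OF pq(2) q1] pq(3) by simp
    then have "real_of_int q powr v \<le> real_of_int (alg_height \<alpha>) powr v"
      using q1 v0 by (intro powr_mono2) auto
    moreover define W where "W = real_of_int (alg_height \<alpha>) powr v"
    ultimately have "5200 * \<bar>\<xi> - \<alpha>\<bar> * (Z * real_of_int q powr v) \<le> 5200 * \<bar>\<xi> - \<alpha>\<bar> * (Z * W)"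
      using Z0 by (intro mult_left_mono) auto
    then have *: "c' \<le> 5200 * \<bar>\<xi> - \<alpha>\<bar> * (Z * W)"
      using effective_hall_approximation[OF c'(2,1) eps r u v \<xi> q1, of p] unfolding Z_def pq(3) by linarith
    \<comment> \<open>The inequality itself excludes \<open>W = 0\<close>, since \<open>c'\<close>
      is positive.\<close>
    then have "W \<noteq> 0" using c' by auto
    then have "W > 0" by (simp add: W_def)
    then have "c' / 5200 / Z / W \<le> \<bar>\<xi> - \<alpha>\<bar>" using * Z0 by (simp add: field_simps)
    then show ?thesis by (simp add: powr_minus_divide Z_def W_def)
  qed
  then have "\<exists>c>0. \<forall>\<xi>\<in>real_alg_of_degree 3. \<forall>\<alpha>\<in>\<rat>.
      \<bar>\<xi> - \<alpha>\<bar> \<ge> c * real_of_int (alg_height \<xi>) powr (- u) * real_of_int (alg_height \<alpha>) powr (- v)"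
    using c'(1) by (intro exI[of _ "c' / 5200"]) auto
  then show ?thesis using u0 v0 unfolding D31_def by simp
qed

text \<open>Choosing \<open>C\<close> and \<open>Cstar\<close> before all parameters, as computable
  functions of them, expresses that one algorithm delivers the constants.\<close>

theorem theorem2:
  shows "\<exists>C Cstar :: real list \<Rightarrow> real.
    computable_on {[\<epsilon>, r] | \<epsilon> r. 0 < \<epsilon> \<and> 1/2 + \<epsilon> \<le> r \<and> r \<le> 1} C \<and>
    computable_on {[\<epsilon>, r, c'] | \<epsilon> r c'. 0 < \<epsilon> \<and> 1/2 + \<epsilon> \<le> r \<and> r \<le> 1 \<and> 0 < c'} Cstar \<and>
    (\<forall>\<epsilon>>0. hall_conjecture \<epsilon> \<longrightarrow>
      (\<exists>c\<^sub>\<epsilon>>0. \<forall>Q :: int poly. \<forall>A B :: real.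
         irreducible Q \<longrightarrow> degree Q = 3 \<longrightarrow>
         B = real_of_int \<bar>lead_coeff Q\<bar> \<longrightarrow> A = real_of_int (naive_height Q) / B \<longrightarrow>
         root_sep Q \<ge> c\<^sub>\<epsilon> / (B powr (2 + 1/2 + \<epsilon>) * A powr (2 - 1/2 + \<epsilon>))) \<and>
      (\<forall>r u v :: real. 1/2 + \<epsilon> \<le> r \<longrightarrow> r \<le> 1 \<longrightarrow>
         u = 2 * r + 2 * (1 - r) / (1/2 - \<epsilon>) \<longrightarrow> v = 2 + r \<longrightarrow>
         (u, v) \<in> D31 \<and>
         (C [\<epsilon>, r] > 0 \<and>
          finite {(\<xi>, real_of_int p / real_of_int q) | (\<xi> :: real) (p :: int) (q :: int).
            \<xi> \<in> real_alg_of_degree 3 \<and> q \<ge> 1 \<and>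
            \<not> (\<bar>\<xi> - real_of_int p / real_of_int q\<bar>
                 > C [\<epsilon>, r] / (real_of_int (alg_height \<xi>) powr u * real_of_int q powr v))}) \<and>
         (\<forall>c'>0. effective_hall \<epsilon> c' \<longrightarrow>
            Cstar [\<epsilon>, r, c'] > 0 \<and>
            (\<forall>\<xi>\<in>real_alg_of_degree 3. \<forall>p q :: int. q \<ge> 1 \<longrightarrow>
               \<bar>\<xi> - real_of_int p / real_of_int q\<bar>
                 > Cstar [\<epsilon>, r, c'] * real_of_int (alg_height \<xi>) powr (- u) * real_of_int q powr (- v)))))"
proof -
  \<comment> \<open>For \<open>C\<close> any positive constant below \<open>1 / 5200\<close> would do; \<open>r / 2 ^ 13\<close> has the advantage that it
    is read off the oracle for \<open>r\<close>. For \<open>Cstar\<close> the Hall constant enters as its square root, which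
    exceeds \<open>c'\<close> because Hall's inequality at \<open>(1, 0)\<close> forces \<open>c' < 1\<close>.\<close>
  define C Cstar :: "real list \<Rightarrow> real" where
    "C = (\<lambda>xs. xs ! 1 / 2 ^ 13)" and "Cstar = (\<lambda>xs. xs ! 2 / 2 ^ 13)"
  have C: "computable_on {[\<epsilon>, r] | \<epsilon> r. 0 < \<epsilon> \<and> 1/2 + \<epsilon> \<le> r \<and> r \<le> 1} C"
    unfolding C_def by (intro computable_on_div_power2 computable_on_nth) auto
  have Cstar: "computable_on {[\<epsilon>, r, c'] | \<epsilon> r c'. 0 < \<epsilon> \<and> 1/2 + \<epsilon> \<le> r \<and> r \<le> 1 \<and> 0 < c'} Cstar"
    unfolding Cstar_def by (intro computable_on_div_power2 computable_on_nth) auto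
  have iii: "C [\<epsilon>, r] > 0 \<and>
      finite {(\<xi>, real_of_int p / real_of_int q) | (\<xi> :: real) (p :: int) (q :: int).
        \<xi> \<in> real_alg_of_degree 3 \<and> q \<ge> 1 \<and>
        \<not> (\<bar>\<xi> - real_of_int p / real_of_int q\<bar>
             > C [\<epsilon>, r] / (real_of_int (alg_height \<xi>) powr u * real_of_int q powr v))}"
    if hall: "hall_conjecture \<epsilon>" and eps: "\<epsilon> > 0" and r: "1/2 + \<epsilon> \<le> r" "r \<le> 1"
      and u: "u = 2 * r + 2 * (1 - r) / (1/2 - \<epsilon>)" and v: "v = 2 + r" for \<epsilon> r u v
  proof
    show "C [\<epsilon>, r] > 0" using r eps by (simp add: C_def)
    have bad: "5200 * \<bar>\<xi> - real_of_int p / real_of_int q\<bar>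
        * (real_of_int (alg_height \<xi>) powr u * real_of_int q powr v) < 1"
      if \<xi>: "\<xi> \<in> real_alg_of_degree 3" "q \<ge> 1"
        and le: "\<not> (\<bar>\<xi> - real_of_int p / real_of_int q\<bar>
             > C [\<epsilon>, r] / (real_of_int (alg_height \<xi>) powr u * real_of_int q powr v))" for \<xi> p q
    proof -
      define s Z where "s = \<bar>\<xi> - real_of_int p / real_of_int q\<bar>"
        and "Z = real_of_int (alg_height \<xi>) powr u * real_of_int q powr v"
      have "alg_height \<xi> \<ge> 1"
        using real_alg_of_degree_3_cubic_approx[OF \<xi>] cubic_approx.h_ge_1 by blast
      then have Z0: "Z > 0" using \<xi>(2) by (simp add: Z_def)
      have "s \<le> r / 8192 / Z" using le by (simp add: C_def s_def Z_def)
      then have "s * Z \<le> r / 8192" using Z0 by (simp add: le_divide_eq)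
      \<comment> \<open>Here 5200 is below \<open>2^13 = 8192\<close> and
        \<open>r \<le> 1\<close>.\<close>
      then have "5200 * (s * Z) < 1" using r by linarith
      then show ?thesis unfolding s_def Z_def by (simp only: mult.assoc)
    qed
    show "finite {(\<xi>, real_of_int p / real_of_int q) | (\<xi> :: real) (p :: int) (q :: int).
        \<xi> \<in> real_alg_of_degree 3 \<and> q \<ge> 1 \<and>
        \<not> (\<bar>\<xi> - real_of_int p / real_of_int q\<bar>
             > C [\<epsilon>, r] / (real_of_int (alg_height \<xi>) powr u * real_of_int q powr v))}"
      by (rule finite_subset[OF _ hall_conjecture_finite_exceptions[OF hall eps r u v]])
         (use bad in blast)
  qed
  have iv: "Cstar [\<epsilon>, r, c'] > 0 \<and>
      (\<forall>\<xi>\<in>real_alg_of_degree 3. \<forall>p q :: int. q \<ge> 1 \<longrightarrow>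
         \<bar>\<xi> - real_of_int p / real_of_int q\<bar>
           > Cstar [\<epsilon>, r, c'] * real_of_int (alg_height \<xi>) powr (- u) * real_of_int q powr (- v))"
    if hall: "effective_hall \<epsilon> c'" "c' > 0" and eps: "\<epsilon> > 0" and r: "1/2 + \<epsilon> \<le> r" "r \<le> 1"
      and u: "u = 2 * r + 2 * (1 - r) / (1/2 - \<epsilon>)" and v: "v = 2 + r" for \<epsilon> r u v c'
  proof (intro conjI ballI allI impI)
    show "Cstar [\<epsilon>, r, c'] > 0" using hall(2) by (simp add: Cstar_def)
    fix \<xi> :: real and p q :: int
    assume \<xi>: "\<xi> \<in> real_alg_of_degree 3" "q \<ge> 1"
    define s Z W where "s = \<bar>\<xi> - real_of_int p / real_of_int q\<bar>"
      and "Z = real_of_int (alg_height \<xi>) powr u" and "W = real_of_int q powr v"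
    have "alg_height \<xi> \<ge> 1"
      using real_alg_of_degree_3_cubic_approx[OF \<xi>] cubic_approx.h_ge_1 by blast
    then have Z0: "Z * W > 0" using \<xi>(2) by (simp add: Z_def W_def)
    have "c' \<le> 5200 * (s * (Z * W))"
      using effective_hall_approximation[OF hall eps r u v \<xi>, of p]
      unfolding s_def Z_def W_def by (simp only: mult.assoc)
    then have "c' / 8192 < s * (Z * W)" using hall(2) by linarith
    then have "c' / 8192 / (Z * W) < s" using Z0 by (simp only: pos_divide_less_eq)
    then have "c' / 8192 / Z / W < s" by simp
    then show "\<bar>\<xi> - real_of_int p / real_of_int q\<bar>
        > Cstar [\<epsilon>, r, c'] * real_of_int (alg_height \<xi>) powr (- u) * real_of_int q powr (- v)"
      by (simp add: Cstar_def s_def Z_def W_def powr_minus_divide)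
  qed
  show ?thesis
    by (rule exI[of _ C], rule exI[of _ Cstar], intro conjI allI impI C Cstar)
       ((rule root_sep_cubic_lower_bound hall_conjecture_imp_D31 iii[THEN conjunct1]
          iii[THEN conjunct2] iv[THEN conjunct1] iv[THEN conjunct2]; assumption)+)
qed

end
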